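(* No comparability graph is ugly, and a good connected ordering of any connected comparability graph can be computed in polynomial time. That is, for every connected comparability graph $G$ there is a connected ordering $\sigma$ of $V(G)$ such that the greedy colouring relative to $\sigma$ uses exactly $\chi(G)$ colours, and such an ordering can be computed in time polynomial in the size of $G$.
   Context: Graphs are finite and simple. A graph is a comparability graph if it admits an acyclic transitive orientation (an orientation is transitive if whenever it contains arcs $a\to b$ and $b\to c$ it contains the arc $a\to c$). Given an ordering $\sigma: v_1,\dots,v_n$ of the vertices of $G$, the greedy colouring relative to $\sigma$ colours $v_1,\dots,v_n$ in this order, assigning to each vertex the smallest positive integer not used by its already coloured neighbours; $\chi(G,\sigma)$ denotes the number of colours used. An ordering $v_1,\dots,v_n$ is connected if for every $i$ the subgraph induced by $v_1,\dots,v_i$ is connected. For a connected graph $G$, $\chi_c(G)$ is the minimum of $\chi(G,\sigma)$ over all connected orderings $\sigma$; a connected graph is ugly if $\chi_c(G)>\chi(G)$. A good connected ordering is a connected ordering $\sigma$ with $\chi(G,\sigma)=\chi(G)$. *)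

theory Defs
  imports "Graph_Theory.Graph_Theory" "HOL-Computational_Algebra.Polynomial"
begin

text \<open>
  Finite simple graphs are the symmetric digraphs of locale \<^locale>\<open>pair_graph\<close>: an edge between
  \<open>u\<close> and \<open>v\<close> is the pair of arcs \<open>(u, v)\<close> and \<open>(v, u)\<close>. The library's notion of connectedness
  requires a nonempty vertex set.
\<close>

definition connected_graph :: "'a pair_pre_digraph \<Rightarrow> bool" where
  "connected_graph G \<longleftrightarrow> pair_graph G \<and> Digraph_Component.connected (with_proj G)"

definition orientation :: "'a pair_pre_digraph \<Rightarrow> 'a rel \<Rightarrow> bool" where
  "orientation G D \<longleftrightarrow>
     D \<subseteq> parcs G \<and> (\<forall>(u, v) \<in> parcs G. ((u, v) \<in> D) \<noteq> ((v, u) \<in> D))"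

definition comparability_graph :: "'a pair_pre_digraph \<Rightarrow> bool" where
  "comparability_graph G \<longleftrightarrow>
     pair_graph G \<and> (\<exists>D. orientation G D \<and> acyclic D \<and> trans D)"


section \<open>Colourings and connected orderings\<close>

definition proper_colouring :: "'a pair_pre_digraph \<Rightarrow> ('a \<Rightarrow> nat) \<Rightarrow> bool" where
  "proper_colouring G c \<longleftrightarrow> (\<forall>(u, v) \<in> parcs G. c u \<noteq> c v)"

definition chromatic_number :: "'a pair_pre_digraph \<Rightarrow> nat" where
  "chromatic_number G = (LEAST k. \<exists>c. proper_colouring G c \<and> c ` pverts G \<subseteq> {1..k})"

primrec greedy_extend :: "'a pair_pre_digraph \<Rightarrow> ('a \<rightharpoonup> nat) \<Rightarrow> 'a list \<Rightarrow> ('a \<rightharpoonup> nat)" where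
  "greedy_extend G c [] = c"
| "greedy_extend G c (v # vs) =
     greedy_extend G
       (c(v \<mapsto> (LEAST k. 1 \<le> k \<and> (\<forall>u. (u, v) \<in> parcs G \<longrightarrow> c u \<noteq> Some k)))) vs"

definition greedy_colouring :: "'a pair_pre_digraph \<Rightarrow> 'a list \<Rightarrow> ('a \<rightharpoonup> nat)" where
  "greedy_colouring G \<sigma> = greedy_extend G Map.empty \<sigma>"

definition greedy_number :: "'a pair_pre_digraph \<Rightarrow> 'a list \<Rightarrow> nat" where
  "greedy_number G \<sigma> = card (ran (greedy_colouring G \<sigma>))"

definition connected_ordering :: "'a pair_pre_digraph \<Rightarrow> 'a list \<Rightarrow> bool" where
  "connected_ordering G \<sigma> \<longleftrightarrow>
     distinct \<sigma> \<and> set \<sigma> = pverts G \<and>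
     (\<forall>i \<in> {1..length \<sigma>}. Digraph_Component.connected (with_proj G \<restriction> set (take i \<sigma>)))"

definition connected_greedy_number :: "'a pair_pre_digraph \<Rightarrow> nat" where
  "connected_greedy_number G = (LEAST k. \<exists>\<sigma>. connected_ordering G \<sigma> \<and> greedy_number G \<sigma> = k)"

definition ugly :: "'a pair_pre_digraph \<Rightarrow> bool" where
  "ugly G \<longleftrightarrow> connected_graph G \<and> connected_greedy_number G > chromatic_number G"

definition good_connected_ordering :: "'a pair_pre_digraph \<Rightarrow> 'a list \<Rightarrow> bool" where
  "good_connected_ordering G \<sigma> \<longleftrightarrow>
     connected_ordering G \<sigma> \<and> greedy_number G \<sigma> = chromatic_number G"


section \<open>Random access machine programs and their running time\<close>

text \<open>
  The model of computation is a deterministic random access machine, presented as a structured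
  imperative language over named arrays of natural numbers (a scalar variable is cell \<open>0\<close> of an
  array). Addition and truncated subtraction are the only arithmetic operations, and every
  assignment and every test costs one step. A program is a fixed finite text, so evaluating an
  expression takes a constant number of machine operations; there is no multiplication, so after
  \<open>t\<close> steps all numbers have \<open>O(t)\<close> more bits than the largest input number. Hence polynomially
  many steps here mean polynomial time on a Turing machine, and conversely.
\<close>

datatype expr =
    Const nat
  | Cell string expr
  | Plus expr expr
  | Minus expr expr

type_synonym state = "string \<Rightarrow> nat \<Rightarrow> nat"

primrec expr_val :: "expr \<Rightarrow> state \<Rightarrow> nat" where
  "expr_val (Const k) s = k"
| "expr_val (Cell x i) s = s x (expr_val i s)"
| "expr_val (Plus a b) s = expr_val a s + expr_val b s"
| "expr_val (Minus a b) s = expr_val a s - expr_val b s"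

text \<open>\<open>Store x i a\<close> is the assignment \<open>x[i] := a\<close>; a test succeeds iff its expression is nonzero.\<close>

datatype com =
    Skip
  | Store string expr expr
  | Seq com com
  | Cond expr com com
  | While expr com

text \<open>\<open>exec c s t s'\<close>: started in \<open>s\<close>, program \<open>c\<close> halts after exactly \<open>t\<close> steps in state \<open>s'\<close>.\<close>

inductive exec :: "com \<Rightarrow> state \<Rightarrow> nat \<Rightarrow> state \<Rightarrow> bool" where
  Skip: "exec Skip s 1 s"
| Store: "exec (Store x i a) s 1 (s(x := (s x)(expr_val i s := expr_val a s)))"
| Seq: "\<lbrakk>exec c1 s t1 s1; exec c2 s1 t2 s2\<rbrakk> \<Longrightarrow> exec (Seq c1 c2) s (t1 + t2) s2"
| CondTrue: "\<lbrakk>expr_val b s \<noteq> 0; exec c1 s t s1\<rbrakk> \<Longrightarrow> exec (Cond b c1 c2) s (1 + t) s1"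
| CondFalse: "\<lbrakk>expr_val b s = 0; exec c2 s t s1\<rbrakk> \<Longrightarrow> exec (Cond b c1 c2) s (1 + t) s1"
| WhileFalse: "expr_val b s = 0 \<Longrightarrow> exec (While b c) s 1 s"
| WhileTrue: "\<lbrakk>expr_val b s \<noteq> 0; exec c s t1 s1; exec (While b c) s1 t2 s2\<rbrakk>
    \<Longrightarrow> exec (While b c) s (1 + t1 + t2) s2"

text \<open>
  A graph on \<open>{..<n}\<close> is given to a program by the number \<open>n\<close> and its adjacency matrix, stored row
  by row; all other memory is zero. An ordering is returned in the first \<open>n\<close> cells of \<open>out\<close>.
\<close>

definition graph_input :: "nat \<Rightarrow> nat pair_pre_digraph \<Rightarrow> state" where
  "graph_input n G = (\<lambda>x k.
     if x = ''n'' \<and> k = 0 then n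
     else if x = ''adj'' \<and> k < n * n \<and> (k div n, k mod n) \<in> parcs G then 1
     else 0)"

definition ordering_output :: "nat \<Rightarrow> state \<Rightarrow> nat list" where
  "ordering_output n s = map (s ''out'') [0..<n]"

text \<open>
  Polynomiality in \<open>n\<close> is polynomiality in the size of the graph, as the input has \<open>n\<^sup>2 + 1\<close> cells.
  The running time is required to be polynomial on inputs with property \<open>P\<close> only; nothing is
  assumed about the behaviour on other inputs.
\<close>

definition poly_time_ordering ::
    "(nat pair_pre_digraph \<Rightarrow> bool) \<Rightarrow> (nat pair_pre_digraph \<Rightarrow> nat list \<Rightarrow> bool) \<Rightarrow> bool" where
  "poly_time_ordering P Q \<longleftrightarrow>
     (\<exists>(c :: com) (p :: nat poly). \<forall>n G. pair_graph G \<and> pverts G = {..<n} \<and> P G \<longrightarrow>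
        (\<exists>t s. exec c (graph_input n G) t s \<and> t \<le> poly p n \<and> Q G (ordering_output n s)))"

end

theory Submission
  imports Defs
begin

text \<open>
  Fix a transitive orientation and peel off the minimal vertices, then the maximal vertices of the
  rest, then the minimal ones again, and so on. A clique inside a later layer extends by a vertex of
  the current layer, so the number of layers is the clique number and layers form an optimal
  colouring. Append vertices one by one, where a vertex may be appended if it has an earlier
  neighbour and an earlier neighbour in every layer before its own; the greedy algorithm then colours
  it by its layer. This process never gets stuck: by downward induction on \<open>i\<close>, what has been placed
  is a union of components of the subgraph on the layers from \<open>i\<close> on. Adjacent vertices above layer
  \<open>i\<close> have a common neighbour in layer \<open>i\<close>, and because directions alternate, a vertex of layer \<open>i\<close>
  enters a component above it through a vertex of layer \<open>i + 1\<close>.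

  A transitive orientation is computed lexicographically: as long as some edge is not oriented, orient
  one with least possible tail away from that tail, together with all arcs that this forces. By the
  triangle lemma, a cyclic triangle in the result would contradict the choice of the tails.
\<close>

section \<open>Transitive orientations\<close>

text \<open>Alternation is essential. If every round removed minimal vertices, the order a < b < v,
  u < v would put u and a on level 0, b on level 1 and v on level 2. The process started at u would
  then be stuck: v has no placed neighbour on level 1, and u has no other neighbour. When round i +
  1 peels from the opposite side, the vertex w of level i + 1 found at or beyond v satisfies u < v
  \<le> w in the direction of round i, so transitivity makes w a neighbour of u. The choice of tails
  is needed because forcing only excludes non-transitive paths whose ends are not adjacent. In a
  triangle no edge forces another, so arbitrary choices can produce a directed cycle. The program is
  never given a transitive orientation. That one exists guarantees that the arcs forced by an arc do
  not include its reverse. Every loop runs at most \<open>n * n\<close> times. The square comes from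
  closing a set of arcs under forcing, where each sweep may gain a single arc. With this uniform
  bound the running time is read off the program text.\<close>

definition orients :: "'a rel \<Rightarrow> 'a rel \<Rightarrow> bool" where
  "orients E D \<longleftrightarrow> D \<inter> D\<inverse> = {} \<and> D \<union> D\<inverse> = E"

lemma orients_iff: "orients E D \<Longrightarrow> (a, b) \<in> E \<longleftrightarrow> (a, b) \<in> D \<or> (b, a) \<in> D"
  by (auto simp: orients_def)

lemma orients_asym: "orients E D \<Longrightarrow> (a, b) \<in> D \<Longrightarrow> (b, a) \<notin> D"
  by (auto simp: orients_def)

lemma orients_converse: "orients E D \<Longrightarrow> orients E (D\<inverse>)"
  by (auto simp: orients_def)

lemma orients_irrefl: "orients E D \<Longrightarrow> (a, a) \<notin> E"
  by (auto simp: orients_def)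

text \<open>
  Every transitive orientation contains both or neither of two related arcs. The relation is
  reflexive on \<open>E\<close>, as \<open>E\<close> will be irreflexive.
\<close>

definition forcing :: "'a rel \<Rightarrow> ('a \<times> 'a) rel" where
  "forcing E = {((a, b), (c, d)). (a, b) \<in> E \<and> (c, d) \<in> E \<and>
     (a = c \<and> (b, d) \<notin> E \<or> b = d \<and> (a, c) \<notin> E)}"

text \<open>Golumbic's implication classes. For symmetric \<open>E\<close> forcing is symmetric, so
  the classes partition the arcs, and a set closed under forcing is a union of classes.\<close>

abbreviation arc_class :: "'a rel \<Rightarrow> 'a \<times> 'a \<Rightarrow> 'a rel" where
  "arc_class E e \<equiv> (forcing E)\<^sup>* `` {e}"

lemma sym_forcing: "sym E \<Longrightarrow> sym (forcing E)"
  by (auto simp: forcing_def sym_def)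

lemma arc_class_sym: "sym E \<Longrightarrow> e \<in> arc_class E f \<Longrightarrow> f \<in> arc_class E e"
  by (auto intro: symD[OF sym_rtrancl[OF sym_forcing]])

lemma forcing_converse:
  assumes "sym E" "(e, f) \<in> forcing E"
  shows "(prod.swap e, prod.swap f) \<in> forcing E"
  using assms by (auto simp: forcing_def sym_def)

lemma arc_class_swap:
  assumes "sym E" "f \<in> arc_class E e"
  shows "prod.swap f \<in> arc_class E (prod.swap e)"
proof -
  from assms(2) have "(e, f) \<in> (forcing E)\<^sup>*" by simp
  then have "(prod.swap e, prod.swap f) \<in> (forcing E)\<^sup>*"
    by (induction) (auto intro: rtrancl_into_rtrancl forcing_converse[OF assms(1)])
  then show ?thesis by simp
qed

lemma arc_class_closed:
  assumes "forcing E `` D \<subseteq> D" "e \<in> D"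
  shows "arc_class E e \<subseteq> D"
proof
  fix f assume "f \<in> arc_class E e"
  then have "(e, f) \<in> (forcing E)\<^sup>*" by simp
  then show "f \<in> D" by induction (use assms in auto)
qed

text \<open>If the forced arc were directed the other way, it would form a directed path with the
  forcing arc, and transitivity would join the two ends that are not adjacent.\<close>

lemma transitive_orientation_forcing_closed:
  assumes T: "orients E T" "trans T"
  shows "forcing E `` T \<subseteq> T"
proof -
  have "(c, d) \<in> T" if "(a, b) \<in> T" "((a, b), (c, d)) \<in> forcing E" for a b c d
    using that T orients_iff[OF T(1)] unfolding forcing_def
    by (auto dest: transD)
  then show ?thesis by auto
qed

text \<open>A transitive orientation contains the whole class of each of its arcs, hence no reverse
  of any of them. If \<open>T\<close> contains \<open>(v, u)\<close> instead of
  \<open>(u, v)\<close>, symmetry of class membership reduces to the same case.\<close>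

lemma comparability_arc_class:
  assumes T: "orients E T" "trans T" and uv: "(u, v) \<in> E"
  shows "(v, u) \<notin> arc_class E (u, v)"
proof
  assume asm: "(v, u) \<in> arc_class E (u, v)"
  have *: "(b, a) \<notin> arc_class E (a, b)" if "(a, b) \<in> T" for a b
    using arc_class_closed[OF transitive_orientation_forcing_closed[OF T] that]
      orients_asym[OF T(1) that] by auto
  have "sym E" using T(1) by (auto simp: orients_def sym_def)
  from uv have "(u, v) \<in> T \<or> (v, u) \<in> T" using orients_iff[OF T(1)] by auto
  then show False using * asm arc_class_sym[OF \<open>sym E\<close> asm] by auto
qed

text \<open>
  Golumbic's triangle lemma.
\<close>

lemma triangle_lemma:
  assumes E: "sym E"
    and tri: "(x, y) \<in> E" "(x, z) \<in> E" "(y, z) \<in> E"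
    and xz: "(x, z) \<notin> arc_class E (y, z)" and yx: "(y, x) \<notin> arc_class E (y, z)"
    and yz': "(y', z') \<in> arc_class E (y, z)"
  shows "(x, y') \<in> arc_class E (x, y)" "(x, z') \<in> arc_class E (x, z)"
    "(x, y') \<in> E" "(x, z') \<in> E"
proof -
  from yz' have "((y, z), (y', z')) \<in> (forcing E)\<^sup>*" by simp
  then have "(x, y') \<in> arc_class E (x, y) \<and> (x, z') \<in> arc_class E (x, z) \<and>
      (x, y') \<in> E \<and> (x, z') \<in> E"
  proof (induction "(y', z')" arbitrary: y' z')
    case base
    then show ?case using tri by simp
  next
    case (step e)
    obtain b c where e: "e = (b, c)" by force
    have arc: "((b, c), (y', z')) \<in> forcing E" using step.hyps e by simp
    have bc: "(b, c) \<in> arc_class E (y, z)" using step.hyps e by simp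
    have IH: "(x, b) \<in> arc_class E (x, y)" "(x, c) \<in> arc_class E (x, z)" "(x, b) \<in> E" "(x, c) \<in> E"
      using step.hyps(3)[OF e] by auto
    have bE: "(b, x) \<in> E" "(c, x) \<in> E" using IH E by (auto dest: symD)
    \<comment> \<open>By induction \<open>(b, x)\<close> lies in the class of \<open>(y, x)\<close>,
      which differs from the class of \<open>(y, z)\<close>. The dual argument gives
      \<open>xc\<close>. These two facts exclude the missing edges below, as a missing edge would
      force \<open>(b, x)\<close> or \<open>(x, c)\<close>.\<close>
    have bx: "(b, x) \<notin> arc_class E (y, z)"
    proof
      assume "(b, x) \<in> arc_class E (y, z)"
      then have "(y, z) \<in> arc_class E (b, x)" using arc_class_sym[OF E] by blast
      moreover have "(b, x) \<in> arc_class E (y, x)" using arc_class_swap[OF E IH(1)] by simp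
      ultimately have "(y, z) \<in> arc_class E (y, x)" by auto
      then show False using yx arc_class_sym[OF E] by blast
    qed
    have xc: "(x, c) \<notin> arc_class E (y, z)"
    proof
      assume "(x, c) \<in> arc_class E (y, z)"
      then have "(y, z) \<in> arc_class E (x, c)" using arc_class_sym[OF E] by blast
      then have "(y, z) \<in> arc_class E (x, z)" using IH(2) by auto
      then show False using xz arc_class_sym[OF E] by blast
    qed
    from arc have E': "(b, c) \<in> E" "(y', z') \<in> E" by (auto simp: forcing_def)
    from arc consider "b = y'" "(c, z') \<notin> E" | "c = z'" "(b, y') \<notin> E"
      by (auto simp: forcing_def)
    then show ?case
    proof cases
      case 1
      have "(x, z') \<in> E"
      proof (rule ccontr)
        assume "(x, z') \<notin> E"
        then have "((y', z'), (b, x)) \<in> forcing E"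
          using 1 E' bE E by (auto simp: forcing_def dest: symD)
        moreover have "((y, z), (y', z')) \<in> (forcing E)\<^sup>*"
          using bc arc by (auto intro: rtrancl_into_rtrancl)
        ultimately have "(b, x) \<in> arc_class E (y, z)" by auto
        then show False using bx by blast
      qed
      moreover from this have "((x, c), (x, z')) \<in> forcing E"
        using 1 IH by (auto simp: forcing_def)
      ultimately show ?thesis using IH 1 by (auto intro: rtrancl_into_rtrancl)
    next
      case 2
      have "(x, y') \<in> E"
      proof (rule ccontr)
        assume "(x, y') \<notin> E"
        then have "((y', z'), (x, c)) \<in> forcing E"
          using 2 E' IH E by (auto simp: forcing_def dest: symD)
        moreover have "((y, z), (y', z')) \<in> (forcing E)\<^sup>*"
          using bc arc by (auto intro: rtrancl_into_rtrancl)
        ultimately have "(x, c) \<in> arc_class E (y, z)" by auto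
        then show False using xc by blast
      qed
      moreover from this have "((x, b), (x, y')) \<in> forcing E"
        using 2 IH by (auto simp: forcing_def)
      ultimately show ?thesis using IH 2 by (auto intro: rtrancl_into_rtrancl)
    qed
  qed
  then show "(x, y') \<in> arc_class E (x, y)" "(x, z') \<in> arc_class E (x, z)"
    "(x, y') \<in> E" "(x, z') \<in> E" by auto
qed

text \<open>The triangle lemma is used twice. With apex \<open>c\<close>, it moves
  \<open>(a, b)\<close> to \<open>(x, y)\<close>, so \<open>x\<close> is covered by the class of
  \<open>(c, a)\<close>; minimality of \<open>p\<close> gives \<open>p = x\<close>. With apex
  \<open>y\<close>, it moves \<open>(c, x)\<close> to \<open>(p, q)\<close>, which replaces
  \<open>c\<close> by the tail \<open>p = x\<close> and yields \<open>(y, x)\<close>, the reverse of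
  an arc of \<open>D\<close>. It matters that the least vertex is a tail: a head would replace
  \<open>x\<close> instead.\<close>

lemma cyclic_triangle_leader:
  fixes D :: "'a::linorder rel"
  assumes D: "orients E D" "forcing E `` D \<subseteq> D"
    and cyc: "(a, b) \<in> D" "(b, c) \<in> D" "(c, a) \<in> D"
    and leader_ab: "(x, y) \<in> arc_class E (a, b)"
    and leader_ca: "(p, q) \<in> arc_class E (c, a)"
      "\<And>s t. (s, t) \<in> arc_class E (c, a) \<union> (arc_class E (c, a))\<inverse> \<Longrightarrow> p \<le> s"
    and less: "x \<le> p"
  shows False
proof -
  have E: "sym E" using D(1) by (auto simp: orients_def sym_def)
  have EI: "(s, t) \<in> E" "(t, s) \<in> E" if "(s, t) \<in> D" for s t
    using orients_iff[OF D(1)] that by auto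
  have cl: "arc_class E e \<subseteq> D" if "e \<in> D" for e
    using arc_class_closed[OF D(2) that] .
  have not: "(t, s) \<notin> arc_class E e" if "(s, t) \<in> D" "e \<in> D" for s t e
    using cl[OF that(2)] orients_asym[OF D(1) that(1)] by auto
  have cx: "(c, x) \<in> arc_class E (c, a)" and cy: "(c, y) \<in> arc_class E (c, b)"
    using triangle_lemma(1,2)[OF E EI(1)[OF cyc(3)] EI(2)[OF cyc(2)] EI(1)[OF cyc(1)]
        not[OF cyc(2,1)] not[OF cyc(3,1)] leader_ab] by auto
  have "p \<le> x" using leader_ca(2)[of x c] cx by auto
  then have p: "p = x" using less by simp
  have xy: "(x, y) \<in> D" using cl cyc leader_ab by auto
  have yc: "(y, c) \<in> D" using arc_class_swap[OF E cy] cl[OF cyc(2)] by auto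
  have cxD: "(c, x) \<in> D" using cl[OF cyc(3)] cx by auto
  have pq: "(p, q) \<in> arc_class E (c, x)"
    using arc_class_sym[OF E cx] leader_ca(1) by auto
  have "(y, p) \<in> arc_class E (y, c)"
    using triangle_lemma(1)[OF E EI(1)[OF yc] EI(2)[OF xy] EI(1)[OF cxD]
        not[OF xy cxD] not[OF yc cxD] pq] .
  then have "(y, x) \<in> D" using cl[OF yc] p by auto
  then show False using orients_asym[OF D(1) xy] by simp
qed

text \<open>
  The last hypothesis says that every class of \<open>D\<close> contains an arc that leaves the least vertex
  covered by the class.
\<close>

lemma leader_orientation_trans:
  fixes D :: "'a::linorder rel"
  assumes D: "orients E D" "forcing E `` D \<subseteq> D"
    and leader: "\<And>e. e \<in> D \<Longrightarrow> \<exists>(x, y) \<in> arc_class E e.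
      \<forall>(s, t) \<in> arc_class E e \<union> (arc_class E e)\<inverse>. x \<le> s"
  shows "trans D"
proof (rule transI, rule ccontr)
  fix a b c assume ab: "(a, b) \<in> D" and bc: "(b, c) \<in> D" and "(a, c) \<notin> D"
  have EI: "(s, t) \<in> E" "(t, s) \<in> E" if "(s, t) \<in> D" for s t
    using orients_iff[OF D(1)] that by auto
  have "(a, c) \<in> E"
  proof (rule ccontr)
    assume "(a, c) \<notin> E"
    then have "((a, b), (c, b)) \<in> forcing E" using EI ab bc by (auto simp: forcing_def)
    then have "(c, b) \<in> D" using D(2) ab by auto
    then show False using orients_asym[OF D(1) bc] by simp
  qed
  then have ca: "(c, a) \<in> D" using \<open>(a, c) \<notin> D\<close> orients_iff[OF D(1)] by auto
  obtain x1 y1 where 1: "(x1, y1) \<in> arc_class E (a, b)"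
    "\<forall>(s, t) \<in> arc_class E (a, b) \<union> (arc_class E (a, b))\<inverse>. x1 \<le> s" using leader[OF ab] by blast
  obtain x2 y2 where 2: "(x2, y2) \<in> arc_class E (b, c)"
    "\<forall>(s, t) \<in> arc_class E (b, c) \<union> (arc_class E (b, c))\<inverse>. x2 \<le> s" using leader[OF bc] by blast
  obtain x3 y3 where 3: "(x3, y3) \<in> arc_class E (c, a)"
    "\<forall>(s, t) \<in> arc_class E (c, a) \<union> (arc_class E (c, a))\<inverse>. x3 \<le> s" using leader[OF ca] by blast
  \<comment> \<open>If all three failed, the leaders would strictly decrease all the way around the
    triangle.\<close>
  consider "x1 \<le> x3" | "x2 \<le> x1" | "x3 \<le> x2"
    using le_cases order_trans by metis
  then show False
  proof cases
    case le: 1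
    show ?thesis
      by (rule cyclic_triangle_leader[OF D ab bc ca 1(1) 3(1) _ le]) (use 3(2) in auto)
  next
    case le: 2
    show ?thesis
      by (rule cyclic_triangle_leader[OF D bc ca ab 2(1) 1(1) _ le]) (use 1(2) in auto)
  next
    case le: 3
    show ?thesis
      by (rule cyclic_triangle_leader[OF D ca ab bc 3(1) 2(1) _ le]) (use 2(2) in auto)
  qed
qed

text \<open>The invariant of the lexicographic algorithm. Its last conjunct records the choice of
  tails class by class, without the order in which the classes were added, so it survives later
  extensions.\<close>

definition partial_orientation :: "'a::linorder rel \<Rightarrow> 'a rel \<Rightarrow> bool" where
  "partial_orientation E D \<longleftrightarrow> D \<subseteq> E \<and> D \<inter> D\<inverse> = {} \<and> forcing E `` D \<subseteq> D \<and>
     (\<forall>e \<in> D. \<exists>(x, y) \<in> arc_class E e. \<forall>(s, t) \<in> arc_class E e \<union> (arc_class E e)\<inverse>. x \<le> s)"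

lemma partial_orientation_full:
  assumes "sym E" "partial_orientation E D" "E \<subseteq> D \<union> D\<inverse>"
  shows "orients E D" "trans D"
proof -
  show "orients E D"
    using assms by (auto simp: partial_orientation_def orients_def dest: symD)
  then show "trans D"
    using assms(2) by (intro leader_orientation_trans) (auto simp: partial_orientation_def)
qed

text \<open>The new class is disjoint from \<open>D\<close> and its reverse because \<open>D\<close>
  is a union of classes, and it contains no arc together with its reverse by
  \<open>comparability_arc_class\<close>. Its least vertex is \<open>u\<close>, since every edge
  with a smaller end is already oriented; so \<open>(u, v)\<close> itself is the required
  arc.\<close>

lemma partial_orientation_extend:
  assumes T: "orients E T" "trans T" and D: "partial_orientation E D"
    and uv: "(u, v) \<in> E" "(u, v) \<notin> D" "(v, u) \<notin> D"
    and before: "\<And>p q. (p, q) \<in> E \<Longrightarrow> p < u \<Longrightarrow> (p, q) \<in> D \<union> D\<inverse>"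
  shows "partial_orientation E (D \<union> arc_class E (u, v))"
proof -
  let ?C = "arc_class E (u, v)"
  have E: "sym E" using T(1) by (auto simp: orients_def sym_def)
  have closed: "forcing E `` D \<subseteq> D" using D by (simp add: partial_orientation_def)
  have CE: "?C \<subseteq> E" by (rule arc_class_closed[OF _ uv(1)]) (auto simp: forcing_def)
  have disj: "e \<notin> D \<and> prod.swap e \<notin> D" if "e \<in> ?C" for e
  proof -
    have "(u, v) \<in> arc_class E e" using arc_class_sym[OF E that] .
    moreover from arc_class_swap[OF E this] have "(v, u) \<in> arc_class E (prod.swap e)" by simp
    ultimately show ?thesis using arc_class_closed[OF closed] uv(2,3) by blast
  qed
  have anti: "(y, x) \<notin> ?C" if "(x, y) \<in> ?C" for x y
  proof
    assume "(y, x) \<in> ?C"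
    with arc_class_sym[OF E that] have "(y, x) \<in> arc_class E (x, y)" by auto
    then show False using comparability_arc_class[OF T] CE that by blast
  qed
  have least: "u \<le> s" if "(s, t) \<in> ?C \<union> ?C\<inverse>" for s t
  proof (rule ccontr)
    assume "\<not> u \<le> s"
    moreover have "(s, t) \<in> E" using that CE E by (auto dest: symD)
    ultimately have "(s, t) \<in> D \<union> D\<inverse>" using before by auto
    then show False using that disj by force
  qed
  have "\<exists>(x, y) \<in> arc_class E e. \<forall>(s, t) \<in> arc_class E e \<union> (arc_class E e)\<inverse>. x \<le> s"
    if "e \<in> D \<union> ?C" for e
  proof (cases "e \<in> ?C")
    case True
    have "arc_class E e = ?C"
      using True arc_class_sym[OF E True] by (auto intro: rtrancl_trans)
    then show ?thesis using least by (intro bexI[of _ "(u, v)"]) auto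
  qed (use that D in \<open>auto simp: partial_orientation_def\<close>)
  moreover have "(D \<union> ?C) \<inter> (D \<union> ?C)\<inverse> = {}"
    using D disj anti unfolding partial_orientation_def by fastforce
  moreover have "forcing E `` (D \<union> ?C) \<subseteq> D \<union> ?C"
    using closed by (auto intro: rtrancl_into_rtrancl)
  moreover have "D \<union> ?C \<subseteq> E" using CE D by (simp add: partial_orientation_def)
  ultimately show ?thesis unfolding partial_orientation_def by blast
qed

section \<open>Alternating levels\<close>

text \<open>
  Levels are counted from \<open>0\<close>: level \<open>i\<close> will get colour \<open>Suc i\<close>.
\<close>

definition turned :: "'a rel \<Rightarrow> nat \<Rightarrow> 'a rel" where
  "turned D i = (if even i then D else D\<inverse>)"

text \<open>Round \<open>i\<close> removes the sources of \<open>turned D i\<close>: the minimal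
  vertices for even \<open>i\<close>, the maximal ones for odd \<open>i\<close>.\<close>

primrec peeled :: "'a rel \<Rightarrow> 'a set \<Rightarrow> nat \<Rightarrow> 'a set" where
  "peeled D V 0 = V"
| "peeled D V (Suc i) = {v \<in> peeled D V i. \<exists>u \<in> peeled D V i. (u, v) \<in> turned D i}"

definition level :: "'a rel \<Rightarrow> 'a set \<Rightarrow> 'a \<Rightarrow> nat" where
  "level D V v = (LEAST i. v \<notin> peeled D V (Suc i))"

lemma peeled_antimono: "i \<le> j \<Longrightarrow> peeled D V j \<subseteq> peeled D V i"
  by (induction j rule: dec_induct) auto

lemma peeled_subset: "peeled D V i \<subseteq> V"
  using peeled_antimono[of 0 i D V] by auto

text \<open>What the ordering argument uses of the orientation. \<open>clique_extend\<close> is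
  applied to single vertices, to edges and to growing cliques; \<open>next_level\<close> is the gain
  from alternating directions.\<close>

locale levelled_graph =
  fixes V :: "'a set" and E :: "'a rel" and lev :: "'a \<Rightarrow> nat"
  assumes finite_V: "finite V"
    and E_sub: "E \<subseteq> V \<times> V"
    and sym_E: "sym E"
    and lev_proper: "(u, v) \<in> E \<Longrightarrow> lev u \<noteq> lev v"
    and clique_extend: "\<lbrakk>K \<subseteq> V; K \<noteq> {}; \<And>x y. x \<in> K \<Longrightarrow> y \<in> K \<Longrightarrow> x \<noteq> y \<Longrightarrow> (x, y) \<in> E;
        \<And>x. x \<in> K \<Longrightarrow> i < lev x\<rbrakk> \<Longrightarrow> \<exists>s \<in> V. lev s = i \<and> (\<forall>x \<in> K. (s, x) \<in> E)"
    and next_level: "\<lbrakk>(u, v) \<in> E; lev u < lev v\<rbrakk>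
        \<Longrightarrow> \<exists>w \<in> V. lev w = Suc (lev u) \<and> (w, u) \<in> E \<and> (w = v \<or> (w, v) \<in> E)"

section \<open>Levels obtained from a transitive orientation\<close>

locale transitive_orientation =
  fixes V :: "'a set" and E D :: "'a rel"
  assumes finite_V: "finite V" and E_sub: "E \<subseteq> V \<times> V"
    and D: "orients E D" and trans_D: "trans D"
begin

lemma trans_turned: "trans (turned D i)"
  using trans_D by (simp add: turned_def)

lemma orients_turned: "orients E (turned D i)"
  using D by (simp add: turned_def orients_converse)

text \<open>Stated for arbitrary \<open>K\<close>, because it serves both the set left after some
  rounds and a clique, where the minimal vertex precedes all others.\<close>

lemma exists_minimal:
  assumes "K \<subseteq> V" "x \<in> K"
  shows "\<exists>s \<in> K. (s = x \<or> (s, x) \<in> turned D i) \<and> (\<forall>u \<in> K. (u, s) \<notin> turned D i)"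
proof -
  define R where "R = turned D i \<inter> K \<times> K"
  have "finite R" using finite_subset[OF assms(1) finite_V] by (auto simp: R_def)
  moreover have "acyclic R"
  proof -
    have tr: "trans R" using trans_turned[of i] by (auto simp: R_def trans_def)
    have "(x, x) \<notin> R" for x
      using orients_asym[OF orients_turned[of i], of x x] by (auto simp: R_def)
    then show ?thesis unfolding acyclic_def trancl_id[OF tr] by simp
  qed
  ultimately have "wf R" by (rule finite_acyclic_wf)
  then show ?thesis using assms(2)
  proof (induction x)
    case (less x)
    show ?case
    proof (cases "\<exists>u \<in> K. (u, x) \<in> turned D i")
      case True
      then obtain u where u: "u \<in> K" "(u, x) \<in> turned D i" by blast
      then have "(u, x) \<in> R" using less.prems by (auto simp: R_def)
      from less.IH[OF this u(1)] show ?thesis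
        using transD[OF trans_turned[of i] _ u(2)] u(2) by blast
    qed (use less.prems in blast)
  qed
qed

lemma exists_unpeeled:
  assumes "v \<in> peeled D V i"
  shows "\<exists>s \<in> peeled D V i - peeled D V (Suc i). s = v \<or> (s, v) \<in> turned D i"
  using exists_minimal[OF peeled_subset assms, of i] by auto

text \<open>A round on a nonempty set removes at least one vertex. Hence \<open>card V\<close>
  rounds remove everything, which justifies the loop bound of the program
  \<open>levels\<close>.\<close>

lemma peeled_shrinks: "peeled D V i \<noteq> {} \<Longrightarrow> card (peeled D V i) + i \<le> card V"
proof (induction i)
  case (Suc i)
  then obtain v where v: "v \<in> peeled D V i" by auto
  obtain s where "s \<in> peeled D V i - peeled D V (Suc i)" using exists_unpeeled[OF v] by blast
  then have "peeled D V (Suc i) \<subset> peeled D V i"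
    using peeled_antimono[of i "Suc i" D V] by (intro psubsetI) auto
  then have "card (peeled D V (Suc i)) < card (peeled D V i)"
    using finite_subset[OF peeled_subset finite_V] by (auto intro!: psubset_card_mono)
  then show ?case using Suc v by fastforce
qed simp

lemma peeled_card: "peeled D V (card V) = {}"
proof (rule ccontr)
  assume "peeled D V (card V) \<noteq> {}"
  moreover from this have "card (peeled D V (card V)) \<noteq> 0"
    using finite_subset[OF peeled_subset finite_V] by simp
  ultimately show False using peeled_shrinks[of "card V"] by simp
qed

lemma le_level_iff:
  assumes "v \<in> V" shows "i \<le> level D V v \<longleftrightarrow> v \<in> peeled D V i"
proof
  assume "i \<le> level D V v"
  then show "v \<in> peeled D V i"
  proof (cases i)
    case (Suc j)
    then have "j < level D V v" using \<open>i \<le> _\<close> by simp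
    then show ?thesis using not_less_Least[of j] Suc unfolding level_def by auto
  qed (use assms in simp)
next
  assume v: "v \<in> peeled D V i"
  have ex: "v \<notin> peeled D V (Suc (card V))"
    using peeled_card peeled_antimono[of "card V" "Suc (card V)" D V] by auto
  have "v \<notin> peeled D V (Suc (level D V v))"
    unfolding level_def by (rule LeastI[of "\<lambda>i. v \<notin> peeled D V (Suc i)", OF ex])
  then show "i \<le> level D V v"
    using v peeled_antimono[of "Suc (level D V v)" i D V] by (meson not_less_eq_eq subsetD)
qed

lemma level_less_card:
  assumes "v \<in> V" shows "level D V v < card V"
  using le_level_iff[OF assms, of "card V"] peeled_card by auto

lemma level_eq_iff:
  assumes "v \<in> V" shows "level D V v = i \<longleftrightarrow> v \<in> peeled D V i - peeled D V (Suc i)"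
  using le_level_iff[OF assms] by (metis Diff_iff not_less_eq_eq order_antisym order_refl)

sublocale levelled_graph V E "level D V"
proof
  show "finite V" "E \<subseteq> V \<times> V" by (fact finite_V E_sub)+
  show "sym E" using D by (auto simp: orients_def sym_def)
next
  fix u v assume uv: "(u, v) \<in> E"
  then have V: "u \<in> V" "v \<in> V" using E_sub by auto
  show "level D V u \<noteq> level D V v"
  proof
    define i where "i = level D V u"
    assume "level D V u = level D V v"
    then have "u \<in> peeled D V i - peeled D V (Suc i)" "v \<in> peeled D V i - peeled D V (Suc i)"
      unfolding level_eq_iff[OF V(1), symmetric] level_eq_iff[OF V(2), symmetric]
      by (simp_all add: i_def)
    \<comment> \<open>Whichever of the two comes second in the direction of round \<open>i\<close>
      has a predecessor in the same set and would survive that round.\<close>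
    moreover have "(u, v) \<in> turned D i \<or> (v, u) \<in> turned D i"
      using orients_iff[OF orients_turned[of i]] uv by blast
    ultimately show False by auto
  qed
next
  fix K i
  assume K: "K \<subseteq> V" "K \<noteq> {}" "\<And>x y. x \<in> K \<Longrightarrow> y \<in> K \<Longrightarrow> x \<noteq> y \<Longrightarrow> (x, y) \<in> E"
    and lev: "\<And>x. x \<in> K \<Longrightarrow> i < level D V x"
  have KP: "x \<in> peeled D V (Suc i)" if "x \<in> K" for x
    using lev[OF that] le_level_iff[of x "Suc i"] that K(1) by auto
  \<comment> \<open>\<open>e\<close> is the first vertex of the clique in the direction of round
    \<open>i\<close>. A source before \<open>e\<close> precedes the whole clique by
    transitivity.\<close>
  obtain e where e: "e \<in> K" "\<forall>u \<in> K. (u, e) \<notin> turned D i"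
    using exists_minimal[OF K(1)] K(2) by blast
  have "e \<in> peeled D V i" using KP[OF e(1)] by simp
  then obtain s where s: "s \<in> peeled D V i - peeled D V (Suc i)" "s = e \<or> (s, e) \<in> turned D i"
    using exists_unpeeled by blast
  then have se: "(s, e) \<in> turned D i" using KP[OF e(1)] by auto
  have "s \<in> V" using s(1) peeled_subset[of D V i] by auto
  moreover have "level D V s = i" using s(1) level_eq_iff[OF \<open>s \<in> V\<close>] by auto
  moreover have "(s, x) \<in> E" if "x \<in> K" for x
  proof (cases "x = e")
    case False
    then have "(e, x) \<in> turned D i"
      using K(3)[of e x] e that orients_iff[OF orients_turned[of i]] by auto
    then have "(s, x) \<in> turned D i" using transD[OF trans_turned se] by blast
    then show ?thesis using orients_iff[OF orients_turned[of i]] by auto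
  qed (use se orients_iff[OF orients_turned[of i]] in auto)
  ultimately show "\<exists>s \<in> V. level D V s = i \<and> (\<forall>x \<in> K. (s, x) \<in> E)" by blast
next
  fix u v
  assume uv: "(u, v) \<in> E" and lt: "level D V u < level D V v"
  define i where "i = level D V u"
  have V: "u \<in> V" "v \<in> V" using E_sub uv by auto
  have u: "u \<in> peeled D V i - peeled D V (Suc i)" unfolding level_eq_iff[OF V(1), symmetric] by (simp add: i_def)
  have v: "v \<in> peeled D V (Suc i)" unfolding le_level_iff[OF V(2), symmetric] using lt i_def by simp
  \<comment> \<open>The other direction would give \<open>u\<close> a predecessor in round
    \<open>i\<close>, although \<open>u\<close> is removed in that round.\<close>
  have uvD: "(u, v) \<in> turned D i"
    using u v uv orients_iff[OF orients_turned[of i]] by auto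
  \<comment> \<open>Here the alternation enters: a predecessor of \<open>v\<close> in round
    \<open>Suc i\<close> is a successor of \<open>v\<close> in round \<open>i\<close>, so
    \<open>(u, v)\<close> and \<open>(v, w)\<close> compose.\<close>
  obtain w where w: "w \<in> peeled D V (Suc i) - peeled D V (Suc (Suc i))"
    "w = v \<or> (w, v) \<in> turned D (Suc i)" using exists_unpeeled[OF v] by blast
  have wV: "w \<in> V" using w(1) peeled_subset[of D V "Suc i"] by blast
  have lw: "level D V w = Suc i" using w(1) level_eq_iff[OF wV] by blast
  have vw: "w = v \<or> (v, w) \<in> turned D i" using w(2) by (auto simp: turned_def)
  then have "(u, w) \<in> turned D i" using uvD transD[OF trans_turned uvD] by blast
  then have "(w, u) \<in> E" using orients_iff[OF orients_turned[of i]] by auto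
  moreover have "w = v \<or> (w, v) \<in> E" using vw orients_iff[OF orients_turned[of i]] by auto
  ultimately show "\<exists>w \<in> V. level D V w = Suc (level D V u) \<and> (w, u) \<in> E \<and> (w = v \<or> (w, v) \<in> E)"
    using wV lw i_def by blast
qed

end

section \<open>Progress of the greedy process, and large cliques\<close>

context levelled_graph
begin

text \<open>The second conjunct keeps the ordering connected: on level \<open>0\<close>, where the
  third is vacuous, it is the only link to \<open>X\<close>. The third makes the greedy algorithm
  reach colour \<open>Suc (lev v)\<close>.\<close>

definition addable :: "'a set \<Rightarrow> 'a \<Rightarrow> bool" where
  "addable X v \<longleftrightarrow> v \<in> V - X \<and> (X = {} \<or> (\<exists>u \<in> X. (u, v) \<in> E)) \<and>
     (\<forall>i < lev v. \<exists>u \<in> X. (u, v) \<in> E \<and> lev u = i)"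

text \<open>
  The induction goes down through the levels: a set closed under the greedy rule that ignores the
  levels below \<open>i\<close> is a union of components of the subgraph on the levels from \<open>i\<close> on.
\<close>

lemma closed_above_level:
  assumes "\<And>u v. \<lbrakk>u \<in> X; (u, v) \<in> E; i \<le> lev u; i \<le> lev v;
      \<And>j. i \<le> j \<Longrightarrow> j < lev v \<Longrightarrow> \<exists>x \<in> X. (x, v) \<in> E \<and> lev x = j\<rbrakk> \<Longrightarrow> v \<in> X"
    and "u \<in> X" "(u, v) \<in> E" "i \<le> lev u" "i \<le> lev v"
  shows "v \<in> X"
  using assms
proof (induction "Suc (Max (lev ` V)) - i" arbitrary: i u v)
  case 0
  have "v \<in> V" using 0(4) E_sub by auto
  then have "lev v \<le> Max (lev ` V)" using finite_V by auto
  then show ?case using 0(1,6) by simp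
next
  case (Suc n)
  note closed = Suc(3)
  have above: "v \<in> X" if "u \<in> X" "(u, v) \<in> E" "Suc i \<le> lev u" "Suc i \<le> lev v" for u v
  proof (rule Suc(1)[OF _ _ that])
    fix u v assume uv: "u \<in> X" "(u, v) \<in> E" "Suc i \<le> lev u" "Suc i \<le> lev v"
      and lower: "\<And>j. Suc i \<le> j \<Longrightarrow> j < lev v \<Longrightarrow> \<exists>x \<in> X. (x, v) \<in> E \<and> lev x = j"
    have "\<exists>s \<in> V. lev s = i \<and> (\<forall>x \<in> {u, v}. (s, x) \<in> E)"
      using uv E_sub sym_E by (intro clique_extend) (auto dest: symD)
    then obtain s where s: "lev s = i" "(s, u) \<in> E" "(s, v) \<in> E" by auto
    \<comment> \<open>\<open>s\<close> lies on the lowest level considered, so its support condition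
      is vacuous and a neighbour in \<open>X\<close> suffices. It then supplies level
      \<open>i\<close>, the one level missing from \<open>lower\<close>.\<close>
    have "s \<in> X"
      by (rule closed[OF uv(1) symD[OF sym_E s(2)]]) (use uv s in simp_all)
    show "v \<in> X"
    proof (rule closed[OF uv(1,2)])
      fix j assume "i \<le> j" "j < lev v"
      then show "\<exists>x \<in> X. (x, v) \<in> E \<and> lev x = j"
        using s \<open>s \<in> X\<close> lower[of j] by (cases "j = i") auto
    qed (use uv in simp_all)
  qed (use Suc(2) in simp)
  consider "lev v = i" | "lev u = i" "i < lev v" | "i < lev u" "i < lev v"
    using Suc(6,7) by linarith
  then show ?case
  proof cases
    case 1
    show ?thesis by (rule closed[OF Suc(4-7)]) (use 1 in simp)
  next
    case 2
    then obtain w where w: "lev w = Suc i" "(w, u) \<in> E" "w = v \<or> (w, v) \<in> E"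
      using next_level[OF Suc(5)] by auto
    have wu: "(u, w) \<in> E" using symD[OF sym_E w(2)] .
    \<comment> \<open>On level \<open>Suc i\<close> the rule asks only for level \<open>i\<close>,
      which \<open>u\<close> supplies. From \<open>w\<close> the vertex \<open>v\<close> is reached
      inside the levels above \<open>i\<close>.\<close>
    have "w \<in> X"
    proof (rule closed[OF Suc(4) wu])
      fix j assume "i \<le> j" "j < lev w"
      then show "\<exists>x \<in> X. (x, w) \<in> E \<and> lev x = j"
        using Suc(4) wu w(1) 2 by (intro bexI[of _ u]) auto
    qed (use 2 w(1) in simp_all)
    then show ?thesis using above[of w v] w 2 by auto
  next
    case 3
    show ?thesis by (rule above[OF Suc(4,5)]) (use 3 in simp_all)
  qed
qed

text \<open>If a nonempty \<open>X\<close> admits no addable vertex,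
  \<open>closed_above_level\<close> with \<open>i = 0\<close> shows that \<open>X\<close> is closed
  under adjacency, so it is all of \<open>V\<close>. For empty \<open>X\<close> any vertex of level
  \<open>0\<close> will do.\<close>

lemma exists_addable:
  assumes conn: "\<And>X. \<lbrakk>X \<subseteq> V; X \<noteq> {}; \<And>u v. u \<in> X \<Longrightarrow> (u, v) \<in> E \<Longrightarrow> v \<in> X\<rbrakk> \<Longrightarrow> X = V"
    and X: "X \<subset> V"
  shows "\<exists>v. addable X v"
proof (cases "X = {}")
  case True
  then obtain v where v: "v \<in> V" using X by auto
  have "\<exists>s \<in> V. lev s = 0"
  proof (cases "lev v = 0")
    case False
    then have "\<exists>s \<in> V. lev s = 0 \<and> (\<forall>x \<in> {v}. (s, x) \<in> E)"
      using v by (intro clique_extend) auto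
    then show ?thesis by auto
  qed (use v in auto)
  then show ?thesis using True by (auto simp: addable_def)
next
  case False
  show ?thesis
  proof (rule ccontr)
    assume no: "\<nexists>v. addable X v"
    have "v \<in> X" if "u \<in> X" "(u, v) \<in> E" for u v
    proof (rule closed_above_level[of X 0, OF _ that])
      fix u v assume uv: "u \<in> X" "(u, v) \<in> E"
        and "\<And>j. 0 \<le> j \<Longrightarrow> j < lev v \<Longrightarrow> \<exists>x \<in> X. (x, v) \<in> E \<and> lev x = j"
      then have "\<forall>j < lev v. \<exists>x \<in> X. (x, v) \<in> E \<and> lev x = j" by blast
      moreover have "\<exists>u \<in> X. (u, v) \<in> E" "v \<in> V" using uv E_sub by blast+
      ultimately show "v \<in> X" using no unfolding addable_def by blast
    qed auto
    then show False using conn[of X] X False by auto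
  qed
qed

text \<open>Descending from \<open>v\<close>, \<open>clique_extend\<close> adds one vertex per
  level. The case \<open>i = 0\<close> is the lower bound for the chromatic number.\<close>

lemma exists_clique:
  assumes "v \<in> V" "i \<le> lev v"
  shows "\<exists>K \<subseteq> V. card K = Suc (lev v - i) \<and> (\<forall>x \<in> K. i \<le> lev x) \<and>
    (\<forall>x \<in> K. \<forall>y \<in> K. x \<noteq> y \<longrightarrow> (x, y) \<in> E)"
  using assms(2)
proof (induction i rule: inc_induct)
  case base
  show ?case by (rule exI[of _ "{v}"]) (use assms in auto)
next
  case (step i)
  then obtain K where K: "K \<subseteq> V" "card K = Suc (lev v - Suc i)" "\<forall>x \<in> K. Suc i \<le> lev x"
    "\<forall>x \<in> K. \<forall>y \<in> K. x \<noteq> y \<longrightarrow> (x, y) \<in> E" by auto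
  have ne: "K \<noteq> {}" using K(2) by auto
  obtain s where s: "s \<in> V" "lev s = i" "\<forall>x \<in> K. (s, x) \<in> E"
    using clique_extend[OF K(1) ne, of i] K(3,4) by (auto simp: Suc_le_eq)
  have "s \<notin> K" using K(3) s(2) by auto
  moreover have "finite K" using K(1) finite_V by (rule finite_subset)
  ultimately have "card (insert s K) = Suc (lev v - i)" using K(2) step.hyps by auto
  moreover have "\<forall>x \<in> insert s K. \<forall>y \<in> insert s K. x \<noteq> y \<longrightarrow> (x, y) \<in> E"
    using K(4) s(3) sym_E by (auto dest: symD)
  moreover have "\<forall>x \<in> insert s K. i \<le> lev x" using K(3) s(2) by (auto intro: Suc_leD)
  moreover have "insert s K \<subseteq> V" using K(1) s(1) by auto
  ultimately show ?case by blast
qed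

end

section \<open>Greedy colourings\<close>

lemma connected_graph_iff:
  assumes "pair_graph G"
  shows "Digraph_Component.connected (with_proj G \<restriction> S) \<longleftrightarrow>
    S \<noteq> {} \<and> (\<forall>u \<in> S. \<forall>v \<in> S. (u, v) \<in> rtrancl_on S (parcs G \<inter> S \<times> S))"
proof -
  interpret pair_graph G by fact
  have "arcs_ends (with_proj G \<restriction> S) = parcs G \<inter> S \<times> S"
    by (auto simp: arcs_ends_conv)
  moreover have "symcl (parcs G \<inter> S \<times> S) = parcs G \<inter> S \<times> S"
    using pair_sym_arcs by (auto simp: symcl_def symmetric_def sym_def image_def)
  ultimately show ?thesis by (simp add: connected_conv)
qed

lemma connected_graph_closed:
  assumes G: "connected_graph G" and X: "X \<subseteq> pverts G" "X \<noteq> {}"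
    and closed: "\<And>u v. u \<in> X \<Longrightarrow> (u, v) \<in> parcs G \<Longrightarrow> v \<in> X"
  shows "X = pverts G"
proof -
  interpret pair_graph G using G by (simp add: connected_graph_def)
  obtain u where u: "u \<in> X" using X by blast
  have "symcl (parcs G) = parcs G"
    using pair_sym_arcs by (auto simp: symcl_def symmetric_def sym_def image_def)
  then have reach: "(u, v) \<in> rtrancl_on (pverts G) (parcs G)" if "v \<in> pverts G" for v
    using G u X(1) that by (auto simp: connected_graph_def connected_conv)
  have "v \<in> X" if "v \<in> pverts G" for v
    using reach[OF that] by (induction rule: rtrancl_on_induct) (use u closed in auto)
  then show ?thesis using X(1) by blast
qed

lemma connected_insert:
  assumes G: "pair_graph G"
    and S: "Digraph_Component.connected (with_proj G \<restriction> S)"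
    and u: "u \<in> S" "(u, v) \<in> parcs G"
  shows "Digraph_Component.connected (with_proj G \<restriction> insert v S)"
proof -
  interpret pair_graph G by fact
  let ?T = "insert v S" and ?R = "rtrancl_on (insert v S) (parcs G \<inter> insert v S \<times> insert v S)"
  have SS: "(x, y) \<in> ?R" if "x \<in> S" "y \<in> S" for x y
  proof (rule rtrancl_on_mono)
    show "(x, y) \<in> rtrancl_on S (parcs G \<inter> S \<times> S)"
      using S that unfolding connected_graph_iff[OF G] by blast
    show "parcs G \<inter> S \<times> S \<subseteq> parcs G \<inter> ?T \<times> ?T" "S \<subseteq> ?T" by blast+
  qed
  have vu: "(v, u) \<in> parcs G" using u(2) pair_sym_arcs by (auto simp: symmetric_def sym_def)
  have uv': "(u, v) \<in> ?R" using u by (auto intro!: rtrancl_on_into_rtrancl_on[OF rtrancl_on_refl])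
  have vu': "(v, u) \<in> ?R" using u vu by (auto intro!: rtrancl_on_into_rtrancl_on[OF rtrancl_on_refl])
  have xu: "(x, u) \<in> ?R \<and> (u, x) \<in> ?R" if "x \<in> ?T" for x
    using that SS u(1) uv' vu' by blast
  have "(x, y) \<in> ?R" if "x \<in> ?T" "y \<in> ?T" for x y
    using rtrancl_on_trans[of x u ?T _ y] xu[OF that(1)] xu[OF that(2)] by blast
  then show ?thesis unfolding connected_graph_iff[OF G] by blast
qed

definition (in levelled_graph) layered :: "'a list \<Rightarrow> bool" where
  "layered \<sigma> \<longleftrightarrow> (\<forall>i < length \<sigma>. addable (set (take i \<sigma>)) (\<sigma> ! i))"

context levelled_graph
begin

lemma layered_Nil: "layered []"
  by (simp add: layered_def)

lemma layered_snoc: "layered (\<sigma> @ [v]) \<longleftrightarrow> layered \<sigma> \<and> addable (set \<sigma>) v"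
  by (auto simp: layered_def less_Suc_eq nth_append)

lemma layered_distinct: "layered \<sigma> \<Longrightarrow> distinct \<sigma> \<and> set \<sigma> \<subseteq> V"
  by (induction \<sigma> rule: rev_induct) (auto simp: layered_snoc addable_def)

lemma layered_prefix: "layered (\<sigma> @ \<tau>) \<Longrightarrow> layered \<sigma>"
  by (induction \<tau> rule: rev_induct) (auto simp: layered_snoc simp flip: append_assoc)

lemma exists_layered:
  assumes conn: "\<And>X. \<lbrakk>X \<subseteq> V; X \<noteq> {}; \<And>u v. u \<in> X \<Longrightarrow> (u, v) \<in> E \<Longrightarrow> v \<in> X\<rbrakk> \<Longrightarrow> X = V"
    and "n \<le> card V"
  shows "\<exists>\<sigma>. layered \<sigma> \<and> length \<sigma> = n"
  using assms(2)
proof (induction n)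
  case (Suc n)
  then obtain \<sigma> where \<sigma>: "layered \<sigma>" "length \<sigma> = n" by auto
  have "card (set \<sigma>) = n" using layered_distinct[OF \<sigma>(1)] \<sigma>(2) by (simp add: distinct_card)
  then have "set \<sigma> \<noteq> V" using Suc.prems by auto
  then have "set \<sigma> \<subset> V" using layered_distinct[OF \<sigma>(1)] by blast
  then have "\<exists>v. addable (set \<sigma>) v" by (intro exists_addable conn)
  then obtain v where "addable (set \<sigma>) v" by blast
  then have "layered (\<sigma> @ [v]) \<and> length (\<sigma> @ [v]) = Suc n" using \<sigma> by (simp add: layered_snoc)
  then show ?case by blast
qed (use layered_Nil in auto)

end

section \<open>Optimality of layered orderings\<close>

locale levelled_pair_graph = levelled_graph "pverts G" "parcs G" lev
  for G :: "'a pair_pre_digraph" and lev +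
  assumes G: "connected_graph G"
begin

lemma pair_graph_G: "pair_graph G"
  using G by (simp add: connected_graph_def)

lemma layered_connected:
  assumes "layered \<sigma>" "\<sigma> \<noteq> []"
  shows "Digraph_Component.connected (with_proj G \<restriction> set \<sigma>)"
  using assms
proof (induction \<sigma> rule: rev_induct)
  case (snoc v \<sigma>)
  show ?case
  proof (cases "\<sigma> = []")
    case True
    then show ?thesis by (simp add: connected_graph_iff[OF pair_graph_G])
  next
    case False
    then have c: "Digraph_Component.connected (with_proj G \<restriction> set \<sigma>)"
      using snoc by (simp add: layered_snoc)
    obtain u where "u \<in> set \<sigma>" "(u, v) \<in> parcs G"
      using snoc.prems False by (auto simp: layered_snoc addable_def)
    from connected_insert[OF pair_graph_G c this] show ?thesis by simp
  qed
qed simp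

text \<open>Generalised over the coloured prefix \<open>\<tau>\<close>. When \<open>v\<close> is
  coloured, each smaller colour is blocked by a neighbour on the corresponding lower level, and
  \<open>Suc (lev v)\<close> is free because adjacent vertices have different levels.\<close>

lemma greedy_layered:
  assumes "layered (\<tau> @ \<sigma>)"
  shows "greedy_extend G (\<lambda>v. if v \<in> set \<tau> then Some (Suc (lev v)) else None) \<sigma> =
    (\<lambda>v. if v \<in> set (\<tau> @ \<sigma>) then Some (Suc (lev v)) else None)"
  using assms
proof (induction \<sigma> arbitrary: \<tau>)
  case (Cons v \<sigma>)
  let ?c = "\<lambda>v. if v \<in> set \<tau> then Some (Suc (lev v)) else None"
  have "layered ((\<tau> @ [v]) @ \<sigma>)" using Cons.prems by simp
  note IH = Cons.IH[OF this]
  have add: "addable (set \<tau>) v"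
    using layered_prefix[of "\<tau> @ [v]" \<sigma>] Cons.prems by (simp add: layered_snoc)
  have "(LEAST k. 1 \<le> k \<and> (\<forall>u. (u, v) \<in> parcs G \<longrightarrow> ?c u \<noteq> Some k)) = Suc (lev v)"
  proof (rule Least_equality)
    show "1 \<le> Suc (lev v) \<and> (\<forall>u. (u, v) \<in> parcs G \<longrightarrow> ?c u \<noteq> Some (Suc (lev v)))"
      using lev_proper by auto
  next
    fix k assume k: "1 \<le> k \<and> (\<forall>u. (u, v) \<in> parcs G \<longrightarrow> ?c u \<noteq> Some k)"
    show "Suc (lev v) \<le> k"
    proof (rule ccontr)
      assume "\<not> Suc (lev v) \<le> k"
      moreover have "1 \<le> k" using k by blast
      ultimately have "k - 1 < lev v" by linarith
      then obtain u where "u \<in> set \<tau>" "(u, v) \<in> parcs G" "lev u = k - 1"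
        using add by (auto simp: addable_def)
      then show False using k by auto
    qed
  qed
  moreover have "?c(v \<mapsto> Suc (lev v)) =
      (\<lambda>u. if u \<in> set (\<tau> @ [v]) then Some (Suc (lev u)) else None)" by auto
  ultimately show ?case using IH by simp
qed auto

text \<open>Both numbers equal \<open>Suc m\<close> for the top level \<open>m\<close>. No level up
  to \<open>m\<close> is empty, so greedy uses that many colours; the shifted levels form a proper
  colouring, and a clique through all levels shows that fewer colours do not suffice.\<close>

lemma layered_good:
  assumes \<sigma>: "layered \<sigma>" and len: "length \<sigma> = card (pverts G)"
  shows "good_connected_ordering G \<sigma>"
proof -
  have dist: "distinct \<sigma>" and sub: "set \<sigma> \<subseteq> pverts G" using layered_distinct[OF \<sigma>] by auto
  have set: "set \<sigma> = pverts G"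
    using card_subset_eq[OF finite_V sub] distinct_card[OF dist] len by simp
  have "Digraph_Component.connected (with_proj G \<restriction> set (take i \<sigma>))" if "i \<in> {1..length \<sigma>}" for i
    using that layered_prefix[of "take i \<sigma>" "drop i \<sigma>"] \<sigma> by (intro layered_connected) auto
  then have conn: "connected_ordering G \<sigma>" using dist set by (auto simp: connected_ordering_def)
  define m where "m = Max (lev ` pverts G)"
  have ne: "pverts G \<noteq> {}" using G by (auto simp: connected_graph_def connected_conv)
  have "m \<in> lev ` pverts G" using ne finite_V by (simp add: m_def)
  then obtain v where v: "v \<in> pverts G" "lev v = m" by auto
  have max: "lev u \<le> m" if "u \<in> pverts G" for u using that finite_V by (simp add: m_def)
  have levels: "lev ` pverts G = {..m}"
  proof
    show "{..m} \<subseteq> lev ` pverts G"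
    proof
      fix i assume "i \<in> {..m}"
      then consider "i = lev v" | "i < lev v" using v by force
      then show "i \<in> lev ` pverts G"
      proof cases
        case 2
        have "\<exists>s \<in> pverts G. lev s = i \<and> (\<forall>x \<in> {v}. (s, x) \<in> parcs G)"
          using v 2 by (intro clique_extend) auto
        then show ?thesis by auto
      qed (use v in auto)
    qed
  qed (use max in auto)
  have "greedy_colouring G \<sigma> = (\<lambda>v. if v \<in> pverts G then Some (Suc (lev v)) else None)"
    using greedy_layered[of "[]" \<sigma>] \<sigma> set by (simp add: greedy_colouring_def)
  then have "ran (greedy_colouring G \<sigma>) = Suc ` lev ` pverts G"
    by (auto simp: ran_def)
  then have number: "greedy_number G \<sigma> = Suc m"
    by (simp add: greedy_number_def levels card_image)
  have "chromatic_number G = Suc m"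
    unfolding chromatic_number_def
  proof (rule Least_equality)
    show "\<exists>c. proper_colouring G c \<and> c ` pverts G \<subseteq> {1..Suc m}"
      using lev_proper max by (intro exI[of _ "Suc \<circ> lev"]) (auto simp: proper_colouring_def)
  next
    fix k assume "\<exists>c. proper_colouring G c \<and> c ` pverts G \<subseteq> {1..k}"
    then obtain c where c: "proper_colouring G c" "c ` pverts G \<subseteq> {1..k}" by auto
    obtain K where K: "K \<subseteq> pverts G" "card K = Suc m"
      "\<forall>x \<in> K. \<forall>y \<in> K. x \<noteq> y \<longrightarrow> (x, y) \<in> parcs G"
      using exists_clique[of v 0] v by auto
    have "inj_on c K" using K(3) c(1) by (force simp: inj_on_def proper_colouring_def)
    moreover have "c ` K \<subseteq> {1..k}" using K(1) c(2) by blast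
    ultimately have "card K \<le> card {1..k}" by (intro card_inj_on_le) auto
    then show "Suc m \<le> k" using K(2) by simp
  qed
  then show ?thesis using conn number by (simp add: good_connected_ordering_def)
qed

lemma exists_good_connected_ordering: "\<exists>\<sigma>. good_connected_ordering G \<sigma>"
proof -
  have "\<exists>\<sigma>. layered \<sigma> \<and> length \<sigma> = card (pverts G)"
    by (intro exists_layered connected_graph_closed[OF G]) simp_all
  then show ?thesis using layered_good by blast
qed

end

section \<open>From comparability graphs to levelled graphs\<close>

lemma comparability_orients:
  assumes "comparability_graph G"
  shows "\<exists>D. orients (parcs G) D \<and> trans D"
proof -
  obtain D where G: "pair_graph G" and D: "orientation G D" "trans D"
    using assms by (auto simp: comparability_graph_def)
  interpret pair_graph G by fact
  have "(v, u) \<in> parcs G" if "(u, v) \<in> parcs G" for u v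
    using that pair_sym_arcs by (auto simp: symmetric_def sym_def)
  then have "orients (parcs G) D" using D(1) by (fastforce simp: orientation_def orients_def)
  then show ?thesis using D(2) by blast
qed

lemma transitive_orientation_pair_graph:
  assumes "pair_graph G" "orients (parcs G) D" "trans D"
  shows "transitive_orientation (pverts G) (parcs G) D"
proof -
  interpret pair_graph G by fact
  show ?thesis using assms pair_finite_verts by unfold_locales (auto dest: wellformed)
qed

lemma levelled_pair_graph_level:
  assumes G: "connected_graph G" and D: "orients (parcs G) D" "trans D"
  shows "levelled_pair_graph G (level D (pverts G))"
proof -
  interpret transitive_orientation "pverts G" "parcs G" D
    using transitive_orientation_pair_graph assms by (auto simp: connected_graph_def)
  show ?thesis by unfold_locales (rule G)
qed

lemma comparability_good_connected_ordering:
  assumes "connected_graph G" "comparability_graph G"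
  shows "\<exists>\<sigma>. good_connected_ordering G \<sigma>"
proof -
  obtain D where "orients (parcs G) D" "trans D" using comparability_orients[OF assms(2)] by blast
  then interpret levelled_pair_graph G "level D (pverts G)"
    by (rule levelled_pair_graph_level[OF assms(1)])
  show ?thesis by (rule exists_good_connected_ordering)
qed

lemma good_connected_ordering_not_ugly:
  assumes "good_connected_ordering G \<sigma>"
  shows "\<not> ugly G"
proof -
  have "connected_greedy_number G \<le> chromatic_number G"
    unfolding connected_greedy_number_def
    using assms by (intro Least_le) (auto simp: good_connected_ordering_def)
  then show ?thesis by (simp add: ugly_def)
qed

section \<open>Programs with bounded loops\<close>

text \<open>A cost bound that depends on the text alone, valid if no execution of a loop exceeds
  \<open>B\<close> iterations. Both branches of a conditional are charged, since a sum of
  polynomials, unlike a maximum, is again a polynomial.\<close>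

primrec run_time :: "nat \<Rightarrow> com \<Rightarrow> nat" where
  "run_time B Skip = 1"
| "run_time B (Store x i a) = 1"
| "run_time B (Seq c1 c2) = run_time B c1 + run_time B c2"
| "run_time B (Cond b c1 c2) = 1 + (run_time B c1 + run_time B c2)"
| "run_time B (While b c) = 1 + B * (1 + run_time B c)"

lemma run_time_poly: "\<exists>p :: nat poly. \<forall>n. run_time (n * n) c = poly p n"
proof (induction c)
  case Skip
  show ?case by (rule exI[of _ 1]) simp
next
  case (Store x i a)
  show ?case by (rule exI[of _ 1]) simp
next
  case (Seq c1 c2)
  then obtain p q :: "nat poly" where "\<forall>n. run_time (n * n) c1 = poly p n"
    "\<forall>n. run_time (n * n) c2 = poly q n" by blast
  then show ?case by (intro exI[of _ "p + q"]) simp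
next
  case (Cond b c1 c2)
  then obtain p q :: "nat poly" where "\<forall>n. run_time (n * n) c1 = poly p n"
    "\<forall>n. run_time (n * n) c2 = poly q n" by blast
  then show ?case by (intro exI[of _ "1 + (p + q)"]) simp
next
  case (While b c)
  then obtain p :: "nat poly" where "\<forall>n. run_time (n * n) c = poly p n" by blast
  \<comment> \<open>The product \<open>[:0, 1:] * [:0, 1:]\<close> evaluates to
    \<open>n * n\<close>, the iteration bound.\<close>
  then show ?case by (intro exI[of _ "1 + [:0, 1:] * [:0, 1:] * (1 + p)"]) (simp add: algebra_simps)
qed

primrec mods :: "com \<Rightarrow> string set" where
  "mods Skip = {}"
| "mods (Store x i a) = {x}"
| "mods (Seq c1 c2) = mods c1 \<union> mods c2"
| "mods (Cond b c1 c2) = mods c1 \<union> mods c2"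
| "mods (While b c) = mods c"

lemma exec_mods: "exec c s t s' \<Longrightarrow> x \<notin> mods c \<Longrightarrow> s' x = s x"
  by (induction rule: exec.induct) auto

text \<open>Total correctness together with the time bound. One run suffices, because
  \<open>poly_time_ordering\<close> asks for the existence of a run.\<close>

definition wp :: "nat \<Rightarrow> com \<Rightarrow> (state \<Rightarrow> bool) \<Rightarrow> state \<Rightarrow> bool" where
  "wp B c Q s \<longleftrightarrow> (\<exists>t s'. exec c s t s' \<and> t \<le> run_time B c \<and> Q s')"

text \<open>Consequence and frame rule in one: arrays that \<open>c\<close> does not write keep
  their contents, so postconditions need not repeat them.\<close>

lemma wp_mono:
  assumes "wp B c P s"
    and "\<And>s'. \<lbrakk>P s'; \<And>x. x \<notin> mods c \<Longrightarrow> s' x = s x\<rbrakk> \<Longrightarrow> Q s'"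
  shows "wp B c Q s"
  using assms exec_mods unfolding wp_def by blast

lemma wp_Skip: "Q s \<Longrightarrow> wp B Skip Q s"
  unfolding wp_def using exec.Skip by fastforce

lemma wp_Store:
  "Q (s(x := (s x)(expr_val i s := expr_val a s))) \<Longrightarrow> wp B (Store x i a) Q s"
  unfolding wp_def using exec.Store by fastforce

lemma wp_Seq:
  assumes "wp B c1 (wp B c2 Q) s"
  shows "wp B (Seq c1 c2) Q s"
proof -
  obtain t1 s1 where 1: "exec c1 s t1 s1" "t1 \<le> run_time B c1" "wp B c2 Q s1"
    using assms unfolding wp_def[of _ c1] by blast
  obtain t2 s2 where 2: "exec c2 s1 t2 s2" "t2 \<le> run_time B c2" "Q s2"
    using 1(3) unfolding wp_def by blast
  show ?thesis unfolding wp_def using exec.Seq[OF 1(1) 2(1)] 1(2) 2(2,3)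
    by (intro exI[of _ "t1 + t2"] exI[of _ s2]) simp
qed

lemma wp_Cond:
  assumes "expr_val b s \<noteq> 0 \<Longrightarrow> wp B c1 Q s" "expr_val b s = 0 \<Longrightarrow> wp B c2 Q s"
  shows "wp B (Cond b c1 c2) Q s"
proof (cases "expr_val b s = 0")
  case True
  obtain t s' where "exec c2 s t s'" "t \<le> run_time B c2" "Q s'"
    using assms(2)[OF True] unfolding wp_def by blast
  then show ?thesis unfolding wp_def using exec.CondFalse[OF True]
    by (intro exI[of _ "1 + t"] exI[of _ s']) simp
next
  case False
  obtain t s' where "exec c1 s t s'" "t \<le> run_time B c1" "Q s'"
    using assms(1)[OF False] unfolding wp_def by blast
  then show ?thesis unfolding wp_def using exec.CondTrue[OF False]
    by (intro exI[of _ "1 + t"] exI[of _ s']) simp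
qed

abbreviation var :: "string \<Rightarrow> expr" where
  "var x \<equiv> Cell x (Const 0)"

abbreviation assign :: "string \<Rightarrow> expr \<Rightarrow> com" where
  "assign x a \<equiv> Store x (Const 0) a"

text \<open>Truncated subtraction turns the test into \<open>i < e\<close>. The bound is evaluated
  anew before each iteration, so the proof rules ask that its value stay fixed.\<close>

definition For :: "string \<Rightarrow> expr \<Rightarrow> com \<Rightarrow> com" where
  "For i e c = Seq (assign i (Const 0))
     (While (Minus e (var i)) (Seq c (assign i (Plus (var i) (Const 1)))))"

lemma mods_For [simp]: "mods (For i e c) = insert i (mods c)"
  by (auto simp: For_def)

text \<open>Induction on the number of remaining iterations. \<open>s0\<close> is the reference
  state for the unmodified arrays, \<open>stable\<close> says that the invariant ignores the counter
  cell, and the 2 pays for test and increment.\<close>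

lemma exec_For_loop:
  assumes i: "i \<notin> mods c"
    and bound: "\<And>s'. (\<And>x. x \<notin> insert i (mods c) \<Longrightarrow> s' x = s0 x) \<Longrightarrow> expr_val e s' = N"
    and stable: "\<And>k s' m. I k s' \<Longrightarrow> I k (s'(i := (s' i)(0 := m)))"
    and body: "\<And>k s'. \<lbrakk>k < N; \<And>x. x \<notin> insert i (mods c) \<Longrightarrow> s' x = s0 x; I k s'; s' i 0 = k\<rbrakk>
      \<Longrightarrow> wp B c (I (Suc k)) s'"
    and k: "k \<le> N" "s i 0 = k" "I k s" "\<And>x. x \<notin> insert i (mods c) \<Longrightarrow> s x = s0 x"
  shows "\<exists>t s'. exec (While (Minus e (var i)) (Seq c (assign i (Plus (var i) (Const 1))))) s t s' \<and>
    t \<le> 1 + (N - k) * (2 + run_time B c) \<and> I N s'"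
  using k
proof (induction "N - k" arbitrary: k s)
  case 0
  have "expr_val (Minus e (var i)) s = 0" using bound[OF 0(5)] 0(1,3) by simp
  from exec.WhileFalse[OF this] have
    "exec (While (Minus e (var i)) (Seq c (assign i (Plus (var i) (Const 1))))) s 1 s" .
  moreover have "k = N" using 0(1,2) by simp
  ultimately show ?case using 0(4) by (intro exI[of _ 1] exI[of _ s]) simp
next
  case (Suc d)
  let ?w = "While (Minus e (var i)) (Seq c (assign i (Plus (var i) (Const 1))))"
  have kN: "k < N" using Suc(2) by simp
  have nz: "expr_val (Minus e (var i)) s \<noteq> 0"
    using bound[OF Suc(6)] kN Suc(4) by simp
  obtain t1 s1 where 1: "exec c s t1 s1" "t1 \<le> run_time B c" "I (Suc k) s1"
    using body[OF kN Suc(6) Suc(5) Suc(4)] unfolding wp_def by blast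
  define s2 where "s2 = s1(i := (s1 i)(0 := Suc k))"
  have fr: "s1 x = s x" if "x \<notin> mods c" for x using exec_mods[OF 1(1) that] .
  have "exec (assign i (Plus (var i) (Const 1))) s1 1 s2"
    using exec.Store[of i "Const 0" "Plus (var i) (Const 1)" s1] fr[OF i] Suc(4)
    by (simp add: s2_def)
  note body_run = exec.Seq[OF 1(1) this]
  have "\<exists>t s'. exec ?w s2 t s' \<and> t \<le> 1 + (N - Suc k) * (2 + run_time B c) \<and> I N s'"
  proof (rule Suc(1))
    show "d = N - Suc k" "Suc k \<le> N" using Suc(2) by auto
    show "s2 i 0 = Suc k" "I (Suc k) s2" using stable[OF 1(3)] by (auto simp: s2_def)
    show "s2 x = s0 x" if "x \<notin> insert i (mods c)" for x
      using that fr Suc(6) by (simp add: s2_def)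
  qed
  then obtain t2 s3 where 2: "exec ?w s2 t2 s3" "t2 \<le> 1 + (N - Suc k) * (2 + run_time B c)" "I N s3"
    by blast
  have "N - k = Suc (N - Suc k)" using kN by simp
  then have "1 + (t1 + 1) + t2 \<le> 1 + (N - k) * (2 + run_time B c)" using 1(2) 2(2) by simp
  then show ?case using exec.WhileTrue[OF nz body_run 2(1)] 2(3) by blast
qed

lemma wp_For:
  assumes "i \<notin> mods c" "N \<le> B"
    and "\<And>s'. (\<And>x. x \<notin> insert i (mods c) \<Longrightarrow> s' x = s x) \<Longrightarrow> expr_val e s' = N"
    and stable: "\<And>k s' m. I k s' \<Longrightarrow> I k (s'(i := (s' i)(0 := m)))"
    and "I 0 s"
    and "\<And>k s'. \<lbrakk>k < N; \<And>x. x \<notin> insert i (mods c) \<Longrightarrow> s' x = s x; I k s'; s' i 0 = k\<rbrakk>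
      \<Longrightarrow> wp B c (I (Suc k)) s'"
  shows "wp B (For i e c) (I N) s"
proof -
  let ?w = "While (Minus e (var i)) (Seq c (assign i (Plus (var i) (Const 1))))"
  define s1 where "s1 = s(i := (s i)(0 := 0))"
  have 1: "exec (assign i (Const 0)) s 1 s1"
    using exec.Store[of i "Const 0" "Const 0" s] by (simp add: s1_def)
  have "\<exists>t s'. exec ?w s1 t s' \<and> t \<le> 1 + (N - 0) * (2 + run_time B c) \<and> I N s'"
  proof (rule exec_For_loop[where ?s0.0 = s])
    show "s1 i 0 = 0" "I 0 s1" using stable[OF assms(5)] by (simp_all add: s1_def)
    show "s1 x = s x" if "x \<notin> insert i (mods c)" for x using that by (simp add: s1_def)
  qed (use assms(1,3,4,6) in blast)+
  then obtain t s' where 2: "exec ?w s1 t s'" "t \<le> 1 + N * (2 + run_time B c)" "I N s'" by auto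
  have "N * (2 + run_time B c) \<le> B * (2 + run_time B c)" using assms(2) by (rule mult_le_mono1)
  then have "1 + t \<le> run_time B (For i e c)" using 2(2) by (simp add: For_def)
  then show ?thesis unfolding wp_def using exec.Seq[OF 1 2(1)] 2(3) unfolding For_def by blast
qed

section \<open>The program\<close>

text \<open>The row-major format of \<open>graph_input\<close>, also used for the computed
  orientation. Being zero beyond the matrix, it allows whole arrays to be compared by
  equality.\<close>

definition enc :: "nat \<Rightarrow> nat rel \<Rightarrow> nat \<Rightarrow> nat" where
  "enc n X k = (if k < n * n \<and> (k div n, k mod n) \<in> X then 1 else 0)"

lemma index_less: "a < n \<Longrightarrow> b < n \<Longrightarrow> a * n + b < n * (n :: nat)"
proof -
  assume "a < n" "b < n"
  then have "a * n + b < Suc a * n" by simp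
  also have "Suc a * n \<le> n * n" using \<open>a < n\<close> by (intro mult_le_mono1) simp
  finally show ?thesis .
qed

lemma enc_at [simp]: "a < n \<Longrightarrow> b < n \<Longrightarrow> enc n X (a * n + b) = (if (a, b) \<in> X then Suc 0 else 0)"
  using index_less[of a n b] by (simp add: enc_def)

lemma enc_insert:
  assumes "a < n" "b < n"
  shows "(enc n X)(a * n + b := Suc 0) = enc n (insert (a, b) X)"
proof
  fix k
  show "((enc n X)(a * n + b := Suc 0)) k = enc n (insert (a, b) X) k"
  proof (cases "k = a * n + b")
    case True
    then show ?thesis using assms by simp
  next
    case False
    then have "(k div n, k mod n) \<noteq> (a, b)" using div_mult_mod_eq[of k n] by auto
    then show ?thesis using False by (simp add: enc_def)
  qed
qed

text \<open>Lacking multiplication, the programs address matrix entries through a table of row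
  offsets. The range includes \<open>u = n\<close> because that cell holds \<open>n * n\<close>, the
  loop bound of \<open>rounds\<close>.\<close>

definition loaded :: "nat \<Rightarrow> nat rel \<Rightarrow> state \<Rightarrow> bool" where
  "loaded n E s \<longleftrightarrow> s ''n'' 0 = n \<and> s ''adj'' = enc n E \<and> (\<forall>u \<le> n. s ''row'' u = u * n)"

lemma loaded_frame:
  "loaded n E s \<Longrightarrow> s' ''n'' = s ''n'' \<Longrightarrow> s' ''adj'' = s ''adj'' \<Longrightarrow> s' ''row'' = s ''row'' \<Longrightarrow>
    loaded n E s'"
  by (simp add: loaded_def)

definition row_table :: com where
  "row_table = For ''u'' (var ''n'') (Store ''row'' (Plus (var ''u'') (Const 1))
     (Plus (Cell ''row'' (var ''u'')) (var ''n'')))"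

lemma wp_row_table:
  assumes "s ''n'' 0 = n" "s ''adj'' = enc n E" "s ''row'' 0 = 0"
  shows "wp (n * n) row_table (loaded n E) s"
proof -
  have "wp (n * n) row_table (\<lambda>s. \<forall>u \<le> n. s ''row'' u = u * n) s"
    unfolding row_table_def
  proof (rule wp_For[where I = "\<lambda>k s. \<forall>u \<le> k. s ''row'' u = u * n"], goal_cases)
    case (6 k s')
    have "s' ''n'' 0 = n" using 6(2)[of "''n''"] assms(1) by simp
    then show ?case using 6(1,3,4) by (intro wp_Store) (auto simp: le_Suc_eq)
  qed (use assms in simp_all)
  then show ?thesis
    by (rule wp_mono) (use assms in \<open>simp add: loaded_def row_table_def\<close>)
qed

lemma loaded_n: "loaded n E s \<Longrightarrow> s ''n'' 0 = n"
  and loaded_adj: "loaded n E s \<Longrightarrow> s ''adj'' = enc n E"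
  and loaded_row: "loaded n E s \<Longrightarrow> u \<le> n \<Longrightarrow> s ''row'' u = u * n"
  by (simp_all add: loaded_def)

abbreviation entry :: "string \<Rightarrow> string \<Rightarrow> string \<Rightarrow> expr" where
  "entry x u v \<equiv> Cell x (Plus (Cell ''row'' (var u)) (var v))"

lemma expr_val_entry:
  assumes "loaded n E s" "s u 0 < n" "s v 0 < n" "s x = enc n X"
  shows "expr_val (entry x u v) s = (if (s u 0, s v 0) \<in> X then Suc 0 else 0)"
  using assms by (simp add: loaded_def)

subsection \<open>Computing a transitive orientation\<close>

text \<open>On 0/1 entries the difference is nonzero only as 2 - 1: both first entries are set and
  the third is not.\<close>

definition force :: "string \<Rightarrow> string \<Rightarrow> string \<Rightarrow> string \<Rightarrow> com" where
  "force p q x y =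
     Cond (Minus (Plus (entry ''D'' ''a'' ''b'') (entry ''adj'' p q)) (Plus (Const 1) (entry ''adj'' x y)))
       (Store ''D'' (Plus (Cell ''row'' (var p)) (var q)) (Const 1)) Skip"

text \<open>The two calls treat the two kinds of forcing by \<open>(a, b)\<close>: onto an arc with
  the same tail and onto one with the same head.\<close>

definition sweep :: com where
  "sweep = For ''a'' (var ''n'') (For ''b'' (var ''n'') (For ''c'' (var ''n'')
     (Seq (force ''a'' ''c'' ''b'' ''c'') (force ''c'' ''b'' ''a'' ''c''))))"

lemma mods_force [simp]: "mods (force p q x y) = {''D''}"
  by (simp add: force_def)

lemma mods_sweep [simp]: "mods sweep = {''a'', ''b'', ''c'', ''D''}"
  by (simp add: sweep_def)

lemma wp_force:
  assumes s: "loaded n E s" "s ''D'' = enc n X" "s ''a'' 0 = a" "s ''b'' 0 = b"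
      "s p 0 = p'" "s q 0 = q'" "s x 0 = x'" "s y 0 = y'"
    and less: "a < n" "b < n" "p' < n" "q' < n" "x' < n" "y' < n"
  shows "wp B (force p q x y) (\<lambda>s'. s' ''D'' = enc n
    (if (a, b) \<in> X \<and> (p', q') \<in> E \<and> (x', y') \<notin> E then insert (p', q') X else X)) s"
proof -
  let ?cond = "(a, b) \<in> X \<and> (p', q') \<in> E \<and> (x', y') \<notin> E"
  have adj: "s ''adj'' = enc n E" and row: "s ''row'' p' = p' * n"
    using s(1) less by (auto simp: loaded_def)
  let ?test = "Minus (Plus (entry ''D'' ''a'' ''b'') (entry ''adj'' p q))
    (Plus (Const 1) (entry ''adj'' x y))"
  have val: "expr_val ?test s \<noteq> 0 \<longleftrightarrow> ?cond"
    unfolding expr_val.simps(3,4)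
    using expr_val_entry[OF s(1), of "''a''" "''b''" "''D''" X]
      expr_val_entry[OF s(1), of p q "''adj''" E] expr_val_entry[OF s(1), of x y "''adj''" E]
      s adj less by simp
  show ?thesis
    unfolding force_def
  proof (rule wp_Cond)
    assume "expr_val ?test s \<noteq> 0"
    then have ?cond using val by simp
    show "wp B (Store ''D'' (Plus (Cell ''row'' (var p)) (var q)) (Const 1)) (\<lambda>s'. s' ''D'' = enc n
        (if ?cond then insert (p', q') X else X)) s"
      unfolding if_P[OF \<open>?cond\<close>] using enc_insert[OF less(3,4), of X]
      by (intro wp_Store) (simp add: s row)
  next
    assume "expr_val ?test s = 0"
    then have "\<not> ?cond" using val by simp
    show "wp B Skip (\<lambda>s'. s' ''D'' = enc n (if ?cond then insert (p', q') X else X)) s"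
      unfolding if_not_P[OF \<open>\<not> ?cond\<close>] using s(2) by (intro wp_Skip)
  qed
qed

section \<open>Closing a set of arcs under forcing\<close>

lemma forcingI:
  assumes "irrefl E" "(a, b) \<in> E"
  shows "(a, c) \<in> E \<Longrightarrow> (b, c) \<notin> E \<Longrightarrow> ((a, b), (a, c)) \<in> forcing E"
    "(c, b) \<in> E \<Longrightarrow> (a, c) \<notin> E \<Longrightarrow> ((a, b), (c, b)) \<in> forcing E"
  using assms by (auto simp: forcing_def)

lemma forcingD:
  assumes "irrefl E"
  shows "((a, b), (a, c)) \<in> forcing E \<Longrightarrow> (a, c) \<in> E \<and> (b, c) \<notin> E"
    "((a, b), (c, b)) \<in> forcing E \<Longrightarrow> (c, b) \<in> E \<and> (a, c) \<notin> E"
  using assms by (auto simp: forcing_def irrefl_def)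

context
  fixes n :: nat and E X0 Cl :: "nat rel"
  assumes E: "E \<subseteq> {..<n} \<times> {..<n}" "irrefl E"
    and Cl: "X0 \<subseteq> Cl" "Cl \<subseteq> E" "forcing E `` Cl \<subseteq> Cl"
begin

text \<open>Only arcs of \<open>X0\<close>, present before the sweep, must have been served. The
  matrix grows during the sweep, and an arc set late may have missed triples already
  visited.\<close>

definition swept :: "nat \<Rightarrow> nat \<Rightarrow> nat \<Rightarrow> nat rel \<Rightarrow> bool" where
  "swept a b c X \<longleftrightarrow> ((a, b) \<in> X0 \<longrightarrow>
     (((a, b), (a, c)) \<in> forcing E \<longrightarrow> (a, c) \<in> X) \<and> (((a, b), (c, b)) \<in> forcing E \<longrightarrow> (c, b) \<in> X))"

lemma swept_mono: "swept a b c X \<Longrightarrow> X \<subseteq> X' \<Longrightarrow> swept a b c X'"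
  by (auto simp: swept_def)

lemma wp_force_pair:
  assumes s: "loaded n E s" "s ''D'' = enc n X" "s ''a'' 0 = a" "s ''b'' 0 = b" "s ''c'' 0 = c"
    and less: "a < n" "b < n" "c < n" and X: "X0 \<subseteq> X" "X \<subseteq> Cl"
  shows "wp B (Seq (force ''a'' ''c'' ''b'' ''c'') (force ''c'' ''b'' ''a'' ''c''))
    (\<lambda>s'. \<exists>X'. s' ''D'' = enc n X' \<and> X \<subseteq> X' \<and> X' \<subseteq> Cl \<and> swept a b c X') s"
proof (rule wp_Seq)
  define X1 where "X1 = (if (a, b) \<in> X \<and> (a, c) \<in> E \<and> (b, c) \<notin> E then insert (a, c) X else X)"
  define X2 where "X2 = (if (a, b) \<in> X1 \<and> (c, b) \<in> E \<and> (a, c) \<notin> E then insert (c, b) X1 else X1)"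
  have Cl_closed: "e \<in> Cl \<Longrightarrow> (e, f) \<in> forcing E \<Longrightarrow> f \<in> Cl" for e f
    using Cl(3) by blast
  have "(a, c) \<in> Cl" if "(a, b) \<in> X" "(a, c) \<in> E" "(b, c) \<notin> E"
    using Cl_closed forcingI(1)[OF E(2) _ that(2,3)] that(1) X Cl by blast
  then have X1: "X \<subseteq> X1" "X1 \<subseteq> Cl" using X by (auto simp: X1_def)
  have "(c, b) \<in> Cl" if "(a, b) \<in> X1" "(c, b) \<in> E" "(a, c) \<notin> E"
    using Cl_closed forcingI(2)[OF E(2) _ that(2,3)] that(1) X1 Cl by blast
  then have X2: "X1 \<subseteq> X2" "X2 \<subseteq> Cl" using X1 by (auto simp: X2_def)
  have "(a, c) \<in> X2" if "(a, b) \<in> X0" "((a, b), (a, c)) \<in> forcing E"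
    using forcingD(1)[OF E(2) that(2)] that(1) X(1) X2(1) by (auto simp: X1_def)
  moreover have "(c, b) \<in> X2" if "(a, b) \<in> X0" "((a, b), (c, b)) \<in> forcing E"
    using forcingD(2)[OF E(2) that(2)] that(1) X(1) X1(1) by (auto simp: X2_def)
  ultimately have *: "X \<subseteq> X2 \<and> X2 \<subseteq> Cl \<and> swept a b c X2"
    using X1 X2 unfolding swept_def by blast
  have "wp B (force ''a'' ''c'' ''b'' ''c'') (\<lambda>s'. s' ''D'' = enc n X1) s"
    unfolding X1_def by (rule wp_force[OF s(1,2)]) (use s less in simp_all)
  then show "wp B (force ''a'' ''c'' ''b'' ''c'') (wp B (force ''c'' ''b'' ''a'' ''c'')
    (\<lambda>s'. \<exists>X'. s' ''D'' = enc n X' \<and> X \<subseteq> X' \<and> X' \<subseteq> Cl \<and> swept a b c X')) s"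
  proof (rule wp_mono)
    fix s1 assume 1: "s1 ''D'' = enc n X1"
      and fr: "\<And>x. x \<notin> mods (force ''a'' ''c'' ''b'' ''c'') \<Longrightarrow> s1 x = s x"
    have s1: "loaded n E s1" "s1 ''a'' 0 = a" "s1 ''b'' 0 = b" "s1 ''c'' 0 = c"
      using fr[of "''a''"] fr[of "''b''"] fr[of "''c''"] s loaded_frame[OF s(1) fr fr fr] by simp_all
    have "wp B (force ''c'' ''b'' ''a'' ''c'') (\<lambda>s'. s' ''D'' = enc n X2) s1"
      unfolding X2_def by (rule wp_force[OF s1(1) 1]) (use s1 less in simp_all)
    then show "wp B (force ''c'' ''b'' ''a'' ''c'')
        (\<lambda>s'. \<exists>X'. s' ''D'' = enc n X' \<and> X \<subseteq> X' \<and> X' \<subseteq> Cl \<and> swept a b c X') s1"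
      by (rule wp_mono) (use * in blast)
  qed
qed

lemma wp_sweep:
  assumes s: "loaded n E s" "s ''D'' = enc n X0"
  shows "wp (n * n) sweep
    (\<lambda>s'. \<exists>X. s' ''D'' = enc n X \<and> X0 \<subseteq> X \<and> X \<subseteq> Cl \<and> forcing E `` X0 \<subseteq> X) s"
proof -
  let ?body = "Seq (force ''a'' ''c'' ''b'' ''c'') (force ''c'' ''b'' ''a'' ''c'')"
  let ?J = "\<lambda>X (s :: state). s ''D'' = enc n X \<and> X0 \<subseteq> X \<and> X \<subseteq> Cl"
  have c_loop: "wp (n * n) (For ''c'' (var ''n'') ?body)
      (\<lambda>s'. \<exists>X'. ?J X' s' \<and> X \<subseteq> X' \<and> (\<forall>c < n. swept a b c X')) s"
    if s: "loaded n E s" "?J X s" "s ''a'' 0 = a" "s ''b'' 0 = b" "a < n" "b < n" for s X a b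
  proof (rule wp_For[where I = "\<lambda>k s'. \<exists>X'. ?J X' s' \<and> X \<subseteq> X' \<and> (\<forall>c < k. swept a b c X')"],
      goal_cases)
    case (3 s')
    show ?case using loaded_n[OF loaded_frame[OF s(1) 3 3 3]] by simp
  next
    case 5
    show ?case using s by blast
  next
    case (6 k s')
    have s': "loaded n E s'" "s' ''a'' 0 = a" "s' ''b'' 0 = b"
      using 6(2)[of "''a''"] 6(2)[of "''b''"] s loaded_frame[OF s(1) 6(2) 6(2) 6(2)] by simp_all
    obtain X1 where X1: "?J X1 s'" "X \<subseteq> X1" "\<forall>c < k. swept a b c X1" using 6(3) by blast
    have "wp (n * n) ?body (\<lambda>s'. \<exists>X'. s' ''D'' = enc n X' \<and> X1 \<subseteq> X' \<and> X' \<subseteq> Cl \<and> swept a b k X') s'"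
      using wp_force_pair[OF s'(1) _ s'(2,3) 6(4) s(5,6) 6(1), of X1] X1(1) by blast
    then show ?case
    proof (rule wp_mono)
      fix s1 assume "\<exists>X'. s1 ''D'' = enc n X' \<and> X1 \<subseteq> X' \<and> X' \<subseteq> Cl \<and> swept a b k X'"
      then obtain X2 where X2: "s1 ''D'' = enc n X2" "X1 \<subseteq> X2" "X2 \<subseteq> Cl" "swept a b k X2" by blast
      have "\<forall>c < Suc k. swept a b c X2" using X1(3) X2(2,4) swept_mono less_Suc_eq by metis
      then show "\<exists>X'. ?J X' s1 \<and> X \<subseteq> X' \<and> (\<forall>c < Suc k. swept a b c X')" using X1 X2 by blast
    qed
  qed simp_all
  have b_loop: "wp (n * n) (For ''b'' (var ''n'') (For ''c'' (var ''n'') ?body))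
      (\<lambda>s'. \<exists>X'. ?J X' s' \<and> X \<subseteq> X' \<and> (\<forall>b < n. \<forall>c < n. swept a b c X')) s"
    if s: "loaded n E s" "?J X s" "s ''a'' 0 = a" "a < n" for s X a
  proof (rule wp_For[where I = "\<lambda>k s'. \<exists>X'. ?J X' s' \<and> X \<subseteq> X' \<and> (\<forall>b < k. \<forall>c < n. swept a b c X')"],
      goal_cases)
    case (3 s')
    show ?case using loaded_n[OF loaded_frame[OF s(1) 3 3 3]] by simp
  next
    case 5
    show ?case using s by blast
  next
    case (6 k s')
    have s': "loaded n E s'" "s' ''a'' 0 = a"
      using 6(2)[of "''a''"] s loaded_frame[OF s(1) 6(2) 6(2) 6(2)] by simp_all
    obtain X1 where X1: "?J X1 s'" "X \<subseteq> X1" "\<forall>b < k. \<forall>c < n. swept a b c X1" using 6(3) by blast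
    show ?case
    proof (rule wp_mono[OF c_loop[OF s'(1) X1(1) s'(2) 6(4) s(4) 6(1)]])
      fix s1 assume "\<exists>X'. ?J X' s1 \<and> X1 \<subseteq> X' \<and> (\<forall>c < n. swept a k c X')"
      then obtain X2 where X2: "?J X2 s1" "X1 \<subseteq> X2" "\<forall>c < n. swept a k c X2" by blast
      have "\<forall>b < Suc k. \<forall>c < n. swept a b c X2" using X1(3) X2(2,3) swept_mono less_Suc_eq by metis
      then show "\<exists>X'. ?J X' s1 \<and> X \<subseteq> X' \<and> (\<forall>b < Suc k. \<forall>c < n. swept a b c X')" using X1(2) X2 by blast
    qed
  qed simp_all
  have "wp (n * n) sweep
      (\<lambda>s'. \<exists>X. ?J X s' \<and> (\<forall>a < n. \<forall>b < n. \<forall>c < n. swept a b c X)) s"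
    unfolding sweep_def
  proof (rule wp_For[where I = "\<lambda>k s'. \<exists>X. ?J X s' \<and> (\<forall>a < k. \<forall>b < n. \<forall>c < n. swept a b c X)"],
      goal_cases)
    case (3 s')
    show ?case using loaded_n[OF loaded_frame[OF s(1) 3 3 3]] by simp
  next
    case 5
    show ?case using s Cl(1) by blast
  next
    case (6 k s')
    have s': "loaded n E s'" using loaded_frame[OF s(1) 6(2) 6(2) 6(2)] by simp
    obtain X1 where X1: "?J X1 s'" "\<forall>a < k. \<forall>b < n. \<forall>c < n. swept a b c X1" using 6(3) by blast
    show ?case
    proof (rule wp_mono[OF b_loop[OF s' X1(1) 6(4) 6(1)]])
      fix s1 assume "\<exists>X'. ?J X' s1 \<and> X1 \<subseteq> X' \<and> (\<forall>b < n. \<forall>c < n. swept k b c X')"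
      then obtain X2 where X2: "?J X2 s1" "X1 \<subseteq> X2" "\<forall>b < n. \<forall>c < n. swept k b c X2" by blast
      have "\<forall>a < Suc k. \<forall>b < n. \<forall>c < n. swept a b c X2"
        using X1(2) X2(2,3) swept_mono less_Suc_eq by metis
      then show "\<exists>X. ?J X s1 \<and> (\<forall>a < Suc k. \<forall>b < n. \<forall>c < n. swept a b c X)" using X2(1) by blast
    qed
  qed simp_all
  then show ?thesis
  proof (rule wp_mono)
    fix s' assume "\<exists>X. ?J X s' \<and> (\<forall>a < n. \<forall>b < n. \<forall>c < n. swept a b c X)"
    then obtain X where X: "?J X s'" "\<forall>a < n. \<forall>b < n. \<forall>c < n. swept a b c X" by blast
    have "(c, d) \<in> X" if "((a, b), (c, d)) \<in> forcing E" "(a, b) \<in> X0" for a b c d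
    proof -
      have "(a, b) \<in> E" "(c, d) \<in> E" using that(1) by (auto simp: forcing_def)
      then have "a < n" "b < n" "c < n" "d < n" using E(1) by auto
      then have "swept a b d X" "swept a b c X" using X(2) by auto
      moreover have "a = c \<or> b = d" using that(1) by (auto simp: forcing_def)
      ultimately show ?thesis using that unfolding swept_def by blast
    qed
    then have "forcing E `` X0 \<subseteq> X" by auto
    then show "\<exists>X. s' ''D'' = enc n X \<and> X0 \<subseteq> X \<and> X \<subseteq> Cl \<and> forcing E `` X0 \<subseteq> X" using X(1) by blast
  qed
qed

end

definition rounds :: com where
  "rounds = For ''r'' (Cell ''row'' (var ''n'')) sweep"

lemma mods_rounds [simp]: "mods rounds = {''r'', ''a'', ''b'', ''c'', ''D''}"
  by (simp add: rounds_def)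

text \<open>A counting argument: after \<open>k\<close> sweeps the set is closed or has more than
  \<open>k\<close> arcs. There are at most \<open>n * n\<close> arcs, so the second alternative
  fails after \<open>n * n\<close> sweeps.\<close>

lemma wp_rounds:
  assumes E: "E \<subseteq> {..<n} \<times> {..<n}" "irrefl E"
    and Cl: "X0 \<subseteq> Cl" "Cl \<subseteq> E" "forcing E `` Cl \<subseteq> Cl" and ne: "X0 \<noteq> {}"
    and s: "loaded n E s" "s ''D'' = enc n X0"
  shows "wp (n * n) rounds
    (\<lambda>s'. \<exists>X. s' ''D'' = enc n X \<and> X0 \<subseteq> X \<and> X \<subseteq> Cl \<and> forcing E `` X \<subseteq> X) s"
proof -
  have fin: "finite Cl" using finite_subset[OF order_trans[OF Cl(2) E(1)]] by simp
  have card_Cl: "card Cl \<le> n * n"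
    using card_mono[OF _ order_trans[OF Cl(2) E(1)]] by (simp add: card_cartesian_product)
  have "wp (n * n) rounds (\<lambda>s'. \<exists>X. s' ''D'' = enc n X \<and> X0 \<subseteq> X \<and> X \<subseteq> Cl \<and>
      (forcing E `` X \<subseteq> X \<or> n * n < card X)) s"
    unfolding rounds_def
  proof (rule wp_For[where I = "\<lambda>k s'. \<exists>X. s' ''D'' = enc n X \<and> X0 \<subseteq> X \<and> X \<subseteq> Cl \<and>
      (forcing E `` X \<subseteq> X \<or> k < card X)"], goal_cases)
    case (6 k s')
    have s': "loaded n E s'" using loaded_frame[OF s(1) 6(2) 6(2) 6(2)] by simp
    obtain X where X: "s' ''D'' = enc n X" "X0 \<subseteq> X" "X \<subseteq> Cl" "forcing E `` X \<subseteq> X \<or> k < card X"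
      using 6(3) by (elim exE conjE) (rule that)
    \<comment> \<open>Once \<open>X\<close> is closed it serves as its own upper bound, so the sweep
      lemma shows that nothing changes any more.\<close>
    obtain Cl' where Cl': "X \<subseteq> Cl'" "Cl' \<subseteq> E" "forcing E `` Cl' \<subseteq> Cl'" "Cl' \<subseteq> Cl"
      and stop: "forcing E `` X \<subseteq> X \<Longrightarrow> Cl' = X"
    proof (cases "forcing E `` X \<subseteq> X")
      case True
      show ?thesis by (rule that[OF order_refl order_trans[OF X(3) Cl(2)] True X(3) refl])
    next
      case False
      show ?thesis by (rule that[OF X(3) Cl(2,3) order_refl]) (rule notE[OF False])
    qed
    show ?case
    proof (rule wp_mono[OF wp_sweep[OF E Cl'(1-3) s' X(1)]])
      fix s1 assume "\<exists>X'. s1 ''D'' = enc n X' \<and> X \<subseteq> X' \<and> X' \<subseteq> Cl' \<and> forcing E `` X \<subseteq> X'"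
      then obtain X' where X': "s1 ''D'' = enc n X'" "X \<subseteq> X'" "X' \<subseteq> Cl'" "forcing E `` X \<subseteq> X'"
        by (elim exE conjE) (rule that)
      have "forcing E `` X' \<subseteq> X' \<or> Suc k < card X'"
      proof (cases "X' = X")
        case False
        have "\<not> forcing E `` X \<subseteq> X"
        proof
          assume "forcing E `` X \<subseteq> X"
          then have "X' \<subseteq> X" using X'(3) stop by simp
          then show False using subset_antisym[OF X'(2)] False by simp
        qed
        moreover have "finite X'" using finite_subset[OF order_trans[OF X'(3) Cl'(4)] fin] .
        then have "card X < card X'" using X'(2) False by (intro psubset_card_mono) auto
        moreover have "k < card X" using X(4) \<open>\<not> forcing E `` X \<subseteq> X\<close> by argo
        ultimately show ?thesis by linarith
      qed (use X'(4) in simp)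
      moreover have "X0 \<subseteq> X'" "X' \<subseteq> Cl" using order_trans[OF X(2) X'(2)] order_trans[OF X'(3) Cl'(4)] .
      ultimately show "\<exists>X. s1 ''D'' = enc n X \<and> X0 \<subseteq> X \<and> X \<subseteq> Cl \<and> (forcing E `` X \<subseteq> X \<or> Suc k < card X)"
        using X'(1) by (intro exI[of _ X'] conjI)
    qed
  next
    case (3 s')
    have "loaded n E s'" using loaded_frame[OF s(1) 3 3 3] by simp
    then show ?case by (simp add: loaded_n loaded_row)
  next
    case 5
    \<comment> \<open>The count starts above \<open>0\<close> because \<open>X0\<close> is nonempty;
      in \<open>orient\<close> it contains the newly chosen arc.\<close>
    have "0 < card X0" using ne finite_subset[OF Cl(1) fin] by (simp add: card_gt_0_iff)
    then show ?case using s(2) Cl(1) by (intro exI[of _ X0]) simp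
  qed simp_all
  then show ?thesis
  proof (rule wp_mono)
    fix s' assume "\<exists>X. s' ''D'' = enc n X \<and> X0 \<subseteq> X \<and> X \<subseteq> Cl \<and> (forcing E `` X \<subseteq> X \<or> n * n < card X)"
    then obtain X where X: "s' ''D'' = enc n X" "X0 \<subseteq> X" "X \<subseteq> Cl" "forcing E `` X \<subseteq> X \<or> n * n < card X"
      by (elim exE conjE) (rule that)
    have "card X \<le> n * n" using card_mono[OF fin X(3)] card_Cl by simp
    then have "\<not> n * n < card X" by simp
    then have "forcing E `` X \<subseteq> X" using X(4) by argo
    then show "\<exists>X. s' ''D'' = enc n X \<and> X0 \<subseteq> X \<and> X \<subseteq> Cl \<and> forcing E `` X \<subseteq> X"
      using X(1-3) by (intro exI[of _ X] conjI)
  qed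
qed

text \<open>The test is nonzero exactly for an edge without direction. Scanning the matrix row by
  row makes \<open>u\<close> the least possible tail, as all edges at smaller vertices have been
  treated.\<close>

definition orient :: com where
  "orient = For ''u'' (var ''n'') (For ''v'' (var ''n'')
     (Cond (Minus (entry ''adj'' ''u'' ''v'') (Plus (entry ''D'' ''u'' ''v'') (entry ''D'' ''v'' ''u'')))
        (Seq (Store ''D'' (Plus (Cell ''row'' (var ''u'')) (var ''v'')) (Const 1)) rounds)
        Skip))"

lemma mods_orient [simp]: "mods orient = {''u'', ''v'', ''r'', ''a'', ''b'', ''c'', ''D''}"
  by (auto simp: orient_def)

lemma wp_orient_arc:
  assumes E: "E \<subseteq> {..<n} \<times> {..<n}" and T: "orients E T" "trans T"
    and s: "loaded n E s" "s ''D'' = enc n D" "s ''u'' 0 = u" "s ''v'' 0 = v" and less: "u < n" "v < n"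
    and D: "partial_orientation E D"
      "\<And>p q. (p, q) \<in> E \<Longrightarrow> p < u \<or> p = u \<and> q < v \<Longrightarrow> (p, q) \<in> D \<union> D\<inverse>"
  shows "wp (n * n)
    (Cond (Minus (entry ''adj'' ''u'' ''v'') (Plus (entry ''D'' ''u'' ''v'') (entry ''D'' ''v'' ''u'')))
      (Seq (Store ''D'' (Plus (Cell ''row'' (var ''u'')) (var ''v'')) (Const 1)) rounds) Skip)
    (\<lambda>s'. \<exists>D'. s' ''D'' = enc n D' \<and> partial_orientation E D' \<and>
      (\<forall>p q. (p, q) \<in> E \<longrightarrow> p < u \<or> p = u \<and> q < Suc v \<longrightarrow> (p, q) \<in> D' \<union> D'\<inverse>)) s"
    (is "wp _ (Cond ?test _ _) ?Q s")
proof (rule wp_Cond)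
  have irr: "irrefl E" using orients_irrefl[OF T(1)] by (simp add: irrefl_def)
  have val: "expr_val ?test s \<noteq> 0 \<longleftrightarrow> (u, v) \<in> E \<and> (u, v) \<notin> D \<and> (v, u) \<notin> D"
    unfolding expr_val.simps(3,4)
    using expr_val_entry[OF s(1), of "''u''" "''v''" "''adj''" E]
      expr_val_entry[OF s(1), of "''u''" "''v''" "''D''" D]
      expr_val_entry[OF s(1), of "''v''" "''u''" "''D''" D] s loaded_adj[OF s(1)] less by simp
  {
    assume "expr_val ?test s \<noteq> 0"
    then have uv: "(u, v) \<in> E" "(u, v) \<notin> D" "(v, u) \<notin> D" using val by auto
    define Cl where "Cl = D \<union> arc_class E (u, v)"
    have Cl: "partial_orientation E Cl"
      unfolding Cl_def by (rule partial_orientation_extend[OF T D(1) uv D(2)]) simp_all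
    have uvCl: "(u, v) \<in> Cl" by (simp add: Cl_def)
    have sub: "insert (u, v) D \<subseteq> Cl" using uvCl by (simp add: Cl_def)
    show "wp (n * n) (Seq (Store ''D'' (Plus (Cell ''row'' (var ''u'')) (var ''v'')) (Const 1)) rounds) ?Q s"
    proof (rule wp_Seq, rule wp_Store)
      let ?s = "s(''D'' := (s ''D'')(expr_val (Plus (Cell ''row'' (var ''u'')) (var ''v'')) s := expr_val (Const 1) s))"
      have s1: "loaded n E ?s" by (rule loaded_frame[OF s(1)]) simp_all
      have s2: "?s ''D'' = enc n (insert (u, v) D)"
        using enc_insert[OF less, of D] loaded_row[OF s(1), of u] s less by simp
      have Cl': "Cl \<subseteq> E" "forcing E `` Cl \<subseteq> Cl" using Cl by (auto simp: partial_orientation_def)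
      show "wp (n * n) rounds ?Q ?s"
      proof (rule wp_mono[OF wp_rounds[OF E irr sub Cl' _ s1 s2]])
        fix s' assume "\<exists>X. s' ''D'' = enc n X \<and> insert (u, v) D \<subseteq> X \<and> X \<subseteq> Cl \<and> forcing E `` X \<subseteq> X"
        then obtain X where X: "s' ''D'' = enc n X" "insert (u, v) D \<subseteq> X" "X \<subseteq> Cl" "forcing E `` X \<subseteq> X"
          by (elim exE conjE) (rule that)
        \<comment> \<open>A closed set containing \<open>(u, v)\<close> contains its whole class, so
          the closure computed by \<open>rounds\<close> is exactly the extension
          \<open>Cl\<close>.\<close>
        have "arc_class E (u, v) \<subseteq> X" by (rule arc_class_closed[OF X(4)]) (use X(2) in simp)
        then have "X = Cl" using X(2,3) by (intro subset_antisym) (simp_all add: Cl_def)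
        then have "s' ''D'' = enc n Cl" using X(1) by simp
        moreover have "(p, q) \<in> Cl \<union> Cl\<inverse>" if "(p, q) \<in> E" "p < u \<or> p = u \<and> q < Suc v" for p q
        proof (cases "p = u \<and> q = v")
          case True
          then show ?thesis using uvCl by simp
        next
          case False
          then have "(p, q) \<in> D \<union> D\<inverse>" using D(2)[OF that(1)] that(2) by (auto simp: less_Suc_eq)
          then show ?thesis by (auto simp: Cl_def)
        qed
        ultimately show "?Q s'" using Cl by (intro exI[of _ Cl]) simp
      qed simp
    qed
  }
  assume "expr_val ?test s = 0"
  then have uv: "(u, v) \<in> E \<Longrightarrow> (u, v) \<in> D \<union> D\<inverse>" using val by auto
  have "(p, q) \<in> D \<union> D\<inverse>" if "(p, q) \<in> E" "p < u \<or> p = u \<and> q < Suc v" for p q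
  proof (cases "p = u \<and> q = v")
    case True
    then show ?thesis using uv that(1) by simp
  next
    case False
    then show ?thesis using D(2)[OF that(1)] that(2) by (auto simp: less_Suc_eq)
  qed
  then show "wp (n * n) Skip ?Q s" using s(2) D(1) by (intro wp_Skip exI[of _ D]) simp
qed

lemma wp_orient:
  assumes E: "E \<subseteq> {..<n} \<times> {..<n}" and T: "orients E T" "trans T"
    and s: "loaded n E s" "s ''D'' = (\<lambda>_. 0)"
  shows "wp (n * n) orient (\<lambda>s'. \<exists>D. s' ''D'' = enc n D \<and> orients E D \<and> trans D) s"
proof -
  define I where "I u v s \<longleftrightarrow> (\<exists>D. s ''D'' = enc n D \<and> partial_orientation E D \<and>
      (\<forall>p q. (p, q) \<in> E \<longrightarrow> p < u \<or> p = u \<and> q < v \<longrightarrow> (p, q) \<in> D \<union> D\<inverse>))" for u v and s :: state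
  have stable: "I u v (s(x := f)) = I u v s" if "x \<noteq> ''D''" for u v s x f
    using that by (simp add: I_def)
  have sE: "sym E" using T(1) by (auto simp: orients_def sym_def)
  have bound: "I (Suc u) 0 s" if "I u n s" for u s
  proof -
    obtain D where D: "s ''D'' = enc n D" "partial_orientation E D"
      "\<And>p q. (p, q) \<in> E \<Longrightarrow> p < u \<or> p = u \<and> q < n \<Longrightarrow> (p, q) \<in> D \<union> D\<inverse>"
      using \<open>I u n s\<close> unfolding I_def by blast
    have "(p, q) \<in> D \<union> D\<inverse>" if "(p, q) \<in> E" "p < Suc u" for p q
    proof (rule D(3)[OF that(1)])
      have "q < n" using that(1) E by auto
      then show "p < u \<or> p = u \<and> q < n" using that(2) by (simp add: less_Suc_eq)
    qed
    then show ?thesis unfolding I_def using D(1,2) by (intro exI[of _ D]) simp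
  qed
  have "wp (n * n) orient (I n 0) s"
    unfolding orient_def
  proof (rule wp_For[where I = "\<lambda>u. I u 0"], goal_cases)
    case (3 s')
    show ?case using loaded_n[OF loaded_frame[OF s(1) 3 3 3]] by simp
  next
    case 5
    have "enc n {} = (\<lambda>_. 0)" by (auto simp: enc_def)
    then show ?case unfolding I_def using s(2)
      by (intro exI[of _ "{}"]) (simp add: partial_orientation_def)
  next
    case (6 u s1)
    have s1: "loaded n E s1" using loaded_frame[OF s(1) 6(2) 6(2) 6(2)] by simp
    show ?case
    proof (rule wp_mono)
      show "wp (n * n) (For ''v'' (var ''n'')
        (Cond (Minus (entry ''adj'' ''u'' ''v'') (Plus (entry ''D'' ''u'' ''v'') (entry ''D'' ''v'' ''u'')))
          (Seq (Store ''D'' (Plus (Cell ''row'' (var ''u'')) (var ''v'')) (Const 1)) rounds) Skip)) (I u n) s1"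
      proof (rule wp_For[where I = "I u"], goal_cases)
        case (3 s')
        show ?case using loaded_n[OF loaded_frame[OF s1 3 3 3]] by simp
      next
        case 5
        show ?case using 6(3) .
      next
        case v: (6 v s2)
        have s2: "loaded n E s2" using loaded_frame[OF s1 v(2) v(2) v(2)] by simp
        have u: "s2 ''u'' 0 = u" using v(2)[of "''u''"] 6(4) by simp
        obtain D where D: "s2 ''D'' = enc n D" "partial_orientation E D"
          "\<And>p q. (p, q) \<in> E \<Longrightarrow> p < u \<or> p = u \<and> q < v \<Longrightarrow> (p, q) \<in> D \<union> D\<inverse>"
          using v(3) unfolding I_def by blast
        show ?case
          unfolding I_def
          by (rule wp_orient_arc[OF E T s2 D(1) u v(4) 6(1) v(1) D(2,3)])
      qed (simp_all add: stable)
    qed (rule bound)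
  qed (simp_all add: stable)
  then show ?thesis
  proof (rule wp_mono)
    fix s' assume "I n 0 s'"
    then obtain D where D: "s' ''D'' = enc n D" "partial_orientation E D"
      "\<And>p q. (p, q) \<in> E \<Longrightarrow> p < n \<Longrightarrow> (p, q) \<in> D \<union> D\<inverse>"
      unfolding I_def by blast
    have "E \<subseteq> D \<union> D\<inverse>"
    proof
      fix e assume "e \<in> E"
      then show "e \<in> D \<union> D\<inverse>" using D(3)[of "fst e" "snd e"] E by auto
    qed
    from partial_orientation_full[OF sE D(2) this] show "\<exists>D. s' ''D'' = enc n D \<and> orients E D \<and> trans D"
      using D(1) by blast
  qed
qed

subsection \<open>Computing the levels\<close>

text \<open>
  \<open>p\<close> holds the parity of the round \<open>i\<close>, which selects the orientation \<open>turned D i\<close>. In round \<open>i\<close>, the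
  vertices outside \<open>peeled D V i\<close> already have their final levels below \<open>i\<close>, and all others have level
  \<open>i\<close> or \<open>Suc i\<close>.
\<close>

definition bump :: com where
  "bump = Cond (Plus (Minus (Plus (entry ''D'' ''v'' ''u'') (var ''p'')) (Const 1))
         (Minus (entry ''D'' ''u'' ''v'') (var ''p'')))
     (Cond (Minus (Plus (Cell ''lev'' (var ''u'')) (Const 1)) (var ''i''))
       (Cond (Minus (Plus (Cell ''lev'' (var ''v'')) (Const 1)) (var ''i''))
         (Store ''lev'' (var ''v'') (Plus (var ''i'') (Const 1))) Skip) Skip) Skip"

definition peel :: com where
  "peel = For ''v'' (var ''n'') (For ''u'' (var ''n'') bump)"

definition levels :: com where
  "levels = For ''i'' (var ''n'') (Seq peel (assign ''p'' (Minus (Const 1) (var ''p''))))"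

lemma mods_bump [simp]: "mods bump = {''lev''}"
  by (simp add: bump_def)

lemma mods_peel [simp]: "mods peel = {''v'', ''u'', ''lev''}"
  by (simp add: peel_def)

lemma mods_levels [simp]: "mods levels = {''i'', ''v'', ''u'', ''lev'', ''p''}"
  by (auto simp: levels_def)

lemma wp_bump:
  assumes s: "loaded n E s" "s ''D'' = enc n D" "s ''u'' 0 = u" "s ''v'' 0 = v" "s ''i'' 0 = i"
      "s ''p'' 0 = i mod 2" and less: "u < n" "v < n"
  shows "wp B bump (\<lambda>s'. s' ''lev'' = (if (u, v) \<in> turned D i \<and> i \<le> s ''lev'' u \<and> i \<le> s ''lev'' v
    then (s ''lev'')(v := Suc i) else s ''lev'')) s"
proof -
  let ?test = "Plus (Minus (Plus (entry ''D'' ''v'' ''u'') (var ''p'')) (Const 1))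
    (Minus (entry ''D'' ''u'' ''v'') (var ''p''))"
  \<comment> \<open>For parity 0 the first difference vanishes and the second is the entry
    \<open>(u, v)\<close>; for parity 1 the second vanishes and the first is the entry
    \<open>(v, u)\<close>.\<close>
  have "expr_val ?test s \<noteq> 0 \<longleftrightarrow> (if even i then (u, v) \<in> D else (v, u) \<in> D)"
    using expr_val_entry[OF s(1), of "''u''" "''v''" "''D''" D]
      expr_val_entry[OF s(1), of "''v''" "''u''" "''D''" D] s less
    by (simp add: parity_cases mod2_eq_if)
  then have val: "expr_val ?test s \<noteq> 0 \<longleftrightarrow> (u, v) \<in> turned D i"
    by (simp add: turned_def)
  show ?thesis
    unfolding bump_def
  proof (intro wp_Cond wp_Skip wp_Store, goal_cases)
    case 1
    then have "(u, v) \<in> turned D i" using val by blast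
    then show ?case using 1(2,3) s(3-5) by (simp add: less_Suc_eq_le)
  next
    case 2
    then show ?case using s(3-5) by simp
  next
    case 3
    then show ?case using s(3-5) by simp
  next
    case 4
    then have "(u, v) \<notin> turned D i" using val by blast
    then show ?case by simp
  qed
qed

lemma wp_peel:
  assumes s: "loaded n E s" "s ''D'' = enc n D" "s ''i'' 0 = i" "s ''p'' 0 = i mod 2"
    and lev: "\<And>w. w < n \<Longrightarrow> i \<le> s ''lev'' w \<longleftrightarrow> w \<in> peeled D {..<n} i"
  shows "wp (n * n) peel (\<lambda>s'. \<forall>w < n. s' ''lev'' w =
    (if w \<in> peeled D {..<n} (Suc i) then Suc i else s ''lev'' w)) s"
proof -
  define lev' where "lev' w = (if w \<in> peeled D {..<n} (Suc i) then Suc i else s ''lev'' w)" for w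
  define J where "J k l s' \<longleftrightarrow> (\<forall>w < n. s' ''lev'' w = (if w < k then lev' w else
      if w = k \<and> (\<exists>u < l. u \<in> peeled D {..<n} i \<and> w \<in> peeled D {..<n} i \<and> (u, w) \<in> turned D i)
      then Suc i else s ''lev'' w))" for k l :: nat and s' :: state
  have J_stable: "J k l (s'(x := f)) = J k l s'" if "x \<noteq> ''lev''" for k l s' x f
    using that by (simp add: J_def)
  \<comment> \<open>Updating in place is harmless: a level raised to \<open>Suc i\<close> is still
    at least \<open>i\<close>, so membership in round \<open>i\<close> remains readable throughout
    the round.\<close>
  have J_le: "i \<le> s' ''lev'' w \<longleftrightarrow> w \<in> peeled D {..<n} i" if "J k l s'" "w < n" for k l s' w
    using that lev[of w] unfolding J_def lev'_def by auto
  have J_next: "J (Suc k) 0 s'" if "J k n s'" for k s'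
    unfolding J_def
  proof (intro allI impI)
    fix w assume w: "w < n"
    have *: "s' ''lev'' w = (if w < k then lev' w else
      if w = k \<and> (\<exists>u < n. u \<in> peeled D {..<n} i \<and> w \<in> peeled D {..<n} i \<and> (u, w) \<in> turned D i)
      then Suc i else s ''lev'' w)" using that w unfolding J_def by blast
    have ex: "(\<exists>u < n. u \<in> peeled D {..<n} i \<and> w \<in> peeled D {..<n} i \<and> (u, w) \<in> turned D i) \<longleftrightarrow>
        w \<in> peeled D {..<n} (Suc i)" using peeled_subset[of D "{..<n}" i] by auto
    show "s' ''lev'' w = (if w < Suc k then lev' w else
      if w = Suc k \<and> (\<exists>u < 0. u \<in> peeled D {..<n} i \<and> w \<in> peeled D {..<n} i \<and> (u, w) \<in> turned D i)
      then Suc i else s ''lev'' w)" unfolding * ex lev'_def by (simp add: less_Suc_eq del: peeled.simps)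
  qed
  have "wp (n * n) peel (J n 0) s"
    unfolding peel_def
  proof (rule wp_For[where I = "\<lambda>k. J k 0"], goal_cases)
    case (3 s')
    show ?case using loaded_n[OF loaded_frame[OF s(1) 3 3 3]] by simp
  next
    case 5
    show ?case by (simp add: J_def)
  next
    case (6 v s1)
    have s1: "loaded n E s1" using loaded_frame[OF s(1) 6(2) 6(2) 6(2)] by simp
    show ?case
    proof (rule wp_mono)
      show "wp (n * n) (For ''u'' (var ''n'') bump) (J v n) s1"
      proof (rule wp_For[where I = "J v"], goal_cases)
        case (3 s')
        show ?case using loaded_n[OF loaded_frame[OF s1 3 3 3]] by simp
      next
        case 5
        show ?case using 6(3) .
      next
        case u: (6 u s2)
        have s2: "loaded n E s2" using loaded_frame[OF s1 u(2) u(2) u(2)] by simp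
        have vars: "s2 ''D'' = enc n D" "s2 ''v'' 0 = v" "s2 ''i'' 0 = i" "s2 ''p'' 0 = i mod 2"
          using u(2)[of "''D''"] u(2)[of "''v''"] u(2)[of "''i''"] u(2)[of "''p''"] 6(4)
            6(2)[of "''D''"] 6(2)[of "''i''"] 6(2)[of "''p''"] s by simp_all
        show ?case
        proof (rule wp_mono[OF wp_bump[OF s2 vars(1) u(4) vars(2-4) u(1) 6(1)]])
          fix s3 assume eq: "s3 ''lev'' = (if (u, v) \<in> turned D i \<and> i \<le> s2 ''lev'' u \<and> i \<le> s2 ''lev'' v
            then (s2 ''lev'')(v := Suc i) else s2 ''lev'')"
          show "J v (Suc u) s3"
            using u(3) unfolding J_def eq J_le[OF u(3) u(1)] J_le[OF u(3) 6(1)]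
            by (auto simp: less_Suc_eq)
        qed
      qed (simp_all add: J_stable)
    qed (rule J_next)
  qed (simp_all add: J_stable)
  then show ?thesis
    by (rule wp_mono) (simp add: J_def lev'_def)
qed

lemma wp_levels:
  assumes D: "transitive_orientation {..<n} E D"
    and s: "loaded n E s" "s ''D'' = enc n D" "s ''p'' 0 = 0" "s ''lev'' = (\<lambda>_. 0)"
  shows "wp (n * n) levels (\<lambda>s'. \<forall>w < n. s' ''lev'' w = level D {..<n} w) s"
proof -
  interpret transitive_orientation "{..<n}" E D by fact
  have "wp (n * n) levels (\<lambda>s'. s' ''p'' 0 = n mod 2 \<and> (\<forall>w < n. s' ''lev'' w = min (level D {..<n} w) n)) s"
    unfolding levels_def
  \<comment> \<open>After \<open>i\<close> rounds the levels are known up to the cutoff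
    \<open>i\<close>. All levels are below \<open>n\<close>, so the cutoff disappears after
    \<open>n\<close> rounds.\<close>
  proof (rule wp_For[where I = "\<lambda>i s'. s' ''p'' 0 = i mod 2 \<and>
      (\<forall>w < n. s' ''lev'' w = min (level D {..<n} w) i)"], goal_cases)
    case (3 s')
    show ?case using loaded_n[OF loaded_frame[OF s(1) 3 3 3]] by simp
  next
    case 5
    show ?case using s by simp
  next
    case (6 i s1)
    have s1: "loaded n E s1" using loaded_frame[OF s(1) 6(2) 6(2) 6(2)] by simp
    have D1: "s1 ''D'' = enc n D" using 6(2)[of "''D''"] s(2) by simp
    have p1: "s1 ''p'' 0 = i mod 2" using 6(3) by blast
    have lev: "i \<le> s1 ''lev'' w \<longleftrightarrow> w \<in> peeled D {..<n} i" if "w < n" for w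
      using 6(3) le_level_iff[of w i] that by simp
    show ?case
    proof (rule wp_Seq, rule wp_mono[OF wp_peel[OF s1 D1 6(4) p1 lev]])
      fix s2 assume 2: "\<forall>w < n. s2 ''lev'' w = (if w \<in> peeled D {..<n} (Suc i) then Suc i else s1 ''lev'' w)"
        and fr: "\<And>x. x \<notin> mods peel \<Longrightarrow> s2 x = s1 x"
      have "s2 ''lev'' w = min (level D {..<n} w) (Suc i)" if w: "w < n" for w
      proof (cases "Suc i \<le> level D {..<n} w")
        case True
        then have "w \<in> peeled D {..<n} (Suc i)" using le_level_iff[of w "Suc i"] w by blast
        then have "s2 ''lev'' w = Suc i" using 2 w by (simp only: if_True)
        then show ?thesis using True by simp
      next
        case False
        then have "w \<notin> peeled D {..<n} (Suc i)" using le_level_iff[of w "Suc i"] w by blast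
        then have "s2 ''lev'' w = s1 ''lev'' w" using 2 w by (simp only: if_False)
        then show ?thesis using False 6(3) w by simp
      qed
      moreover have "s2 ''p'' 0 = i mod 2" using fr[of "''p''"] p1 by simp
      ultimately show "wp (n * n) (assign ''p'' (Minus (Const 1) (var ''p'')))
          (\<lambda>s'. s' ''p'' 0 = Suc i mod 2 \<and> (\<forall>w < n. s' ''lev'' w = min (level D {..<n} w) (Suc i))) s2"
        by (intro wp_Store) (simp add: mod2_eq_if)
    qed
  qed simp_all
  then show ?thesis
  proof (rule wp_mono)
    fix s' assume "s' ''p'' 0 = n mod 2 \<and> (\<forall>w < n. s' ''lev'' w = min (level D {..<n} w) n)"
    then show "\<forall>w < n. s' ''lev'' w = level D {..<n} w"
      using level_less_card by (simp add: min_absorb1 less_imp_le)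
  qed
qed

subsection \<open>Computing the ordering\<close>

text \<open>
  A vertex may be appended if it has an earlier neighbour (\<open>j = 0\<close>) and one on each lower level
  (\<open>j > 0\<close> stands for level \<open>j - 1\<close>). Only the first vertex, placed in round \<open>r = 0\<close>, is exempt from
  having an earlier neighbour.
\<close>

definition look :: com where
  "look = Cond (Cell ''pl'' (var ''u'')) (Cond (entry ''adj'' ''u'' ''v'')
     (Cond (var ''j'')
       (Cond (Plus (Minus (Plus (Cell ''lev'' (var ''u'')) (Const 1)) (var ''j''))
           (Minus (var ''j'') (Plus (Cell ''lev'' (var ''u'')) (Const 1))))
         Skip (assign ''f'' (Const 1)))
       (assign ''f'' (Const 1)))
     Skip) Skip"

text \<open>By truncation \<open>f\<close> starts as 1 only for \<open>r = j = 0\<close>, the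
  exemption of the first vertex; otherwise a supporting vertex must set it.\<close>

definition check_level :: com where
  "check_level = Seq (assign ''f'' (Minus (Minus (Const 1) (var ''r'')) (var ''j'')))
     (Seq (For ''u'' (var ''n'') look) (Cond (var ''f'') Skip (assign ''ok'' (Const 0))))"

definition check_vertex :: com where
  "check_vertex = Seq (assign ''ok'' (Minus (Const 1) (Cell ''pl'' (var ''v''))))
     (Seq (For ''j'' (Plus (Cell ''lev'' (var ''v'')) (Const 1)) check_level)
       (Cond (var ''ok'') (assign ''g'' (Plus (var ''v'') (Const 1))) Skip))"

text \<open>\<open>g\<close> holds the candidate plus one, so that \<open>0\<close> means that none
  was found. A later candidate overwrites an earlier one, as any addable vertex will do.\<close>

definition append_all :: com where
  "append_all = For ''r'' (var ''n'')
     (Seq (Seq (assign ''g'' (Const 0)) (For ''v'' (var ''n'') check_vertex))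
       (Seq (Store ''out'' (var ''r'') (Minus (var ''g'') (Const 1)))
         (Store ''pl'' (Minus (var ''g'') (Const 1)) (Const 1))))"

lemma mods_look [simp]: "mods look = {''f''}"
  by (simp add: look_def)

lemma mods_check_level [simp]: "mods check_level = {''f'', ''u'', ''ok''}"
  by (auto simp: check_level_def)

lemma mods_check_vertex [simp]: "mods check_vertex = {''ok'', ''j'', ''f'', ''u'', ''g''}"
  by (auto simp: check_vertex_def)

section \<open>Correctness of the search for addable vertices\<close>

locale numbered_graph = levelled_graph "{..<n}" E lev
  for n :: nat and E :: "nat rel" and lev :: "nat \<Rightarrow> nat"
begin

definition support :: "nat \<Rightarrow> nat \<Rightarrow> nat \<Rightarrow> bool" where
  "support v j u \<longleftrightarrow> (u, v) \<in> E \<and> (j = 0 \<or> Suc (lev u) = j)"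

text \<open>Shifting the levels by one frees \<open>j = 0\<close> for the connectedness condition,
  so a single loop over \<open>j\<close> checks both conditions.\<close>

lemma addable_iff_support:
  "addable X v \<longleftrightarrow> v \<in> {..<n} - X \<and> (\<forall>j < Suc (lev v). X = {} \<and> j = 0 \<or> (\<exists>u \<in> X. support v j u))"
  unfolding addable_def All_less_Suc2 by (auto simp: support_def)

text \<open>The last conjunct is there because the program recognises the empty set of placed
  vertices by the round counter.\<close>

definition placed :: "nat set \<Rightarrow> state \<Rightarrow> bool" where
  "placed X s \<longleftrightarrow> loaded n E s \<and> (\<forall>w < n. s ''lev'' w = lev w) \<and>
     (\<forall>w < n. s ''pl'' w = (if w \<in> X then 1 else 0)) \<and> (s ''r'' 0 = 0 \<longleftrightarrow> X = {})"

lemma placed_frame: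
  assumes "placed X s" "s' ''n'' = s ''n''" "s' ''adj'' = s ''adj''" "s' ''row'' = s ''row''"
    "s' ''lev'' = s ''lev''" "s' ''pl'' = s ''pl''" "s' ''r'' = s ''r''"
  shows "placed X s'"
  using assms(1) loaded_frame[of n E s s', OF _ assms(2-4)] unfolding placed_def assms(5-7) by blast

lemma placedD:
  assumes "placed X s"
  shows "loaded n E s" "s ''n'' 0 = n" "w < n \<Longrightarrow> s ''lev'' w = lev w"
    "w < n \<Longrightarrow> s ''pl'' w = (if w \<in> X then 1 else 0)" "s ''r'' 0 = 0 \<longleftrightarrow> X = {}"
  using assms unfolding placed_def by (auto simp: loaded_n)

lemma wp_look:
  assumes s: "placed X s" "s ''u'' 0 = u" "s ''v'' 0 = v" "s ''j'' 0 = j" and less: "u < n" "v < n"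
  shows "wp B look (\<lambda>s'. s' ''f'' 0 = (if u \<in> X \<and> support v j u then 1 else s ''f'' 0)) s"
proof -
  have adj: "expr_val (entry ''adj'' ''u'' ''v'') s = (if (u, v) \<in> E then Suc 0 else 0)"
    using expr_val_entry[OF placedD(1)[OF s(1)], of "''u''" "''v''" "''adj''" E]
      loaded_adj[OF placedD(1)[OF s(1)]] s less by simp
  have vals: "s ''lev'' u = lev u" "s ''pl'' u = (if u \<in> X then 1 else 0)"
    using placedD[OF s(1)] less by auto
  have "expr_val (entry ''adj'' ''u'' ''v'') s \<noteq> 0 \<longleftrightarrow> (u, v) \<in> E" using adj by simp
  \<comment> \<open>In \<open>look\<close>, the sum of the two opposite truncated differences is
    zero exactly when \<open>lev u + 1 = j\<close>.\<close>
  then show ?thesis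
    unfolding look_def
    by (intro wp_Cond wp_Skip wp_Store) (use s(2-4) vals in \<open>auto simp: support_def\<close>)
qed

lemma wp_check_level:
  assumes s: "placed X s" "s ''v'' 0 = v" "s ''j'' 0 = j" and v: "v < n" and X: "X \<subseteq> {..<n}"
  shows "wp (n * n) check_level (\<lambda>s'. s' ''ok'' 0 =
    (if X = {} \<and> j = 0 \<or> (\<exists>u \<in> X. support v j u) then s ''ok'' 0 else 0)) s"
  unfolding check_level_def
proof (rule wp_Seq, rule wp_Store, rule wp_Seq)
  let ?e = "Minus (Minus (Const 1) (var ''r'')) (var ''j'')"
  let ?s = "s(''f'' := (s ''f'')(expr_val (Const 0) s := expr_val ?e s))"
  let ?f = "\<lambda>k. if X = {} \<and> j = 0 \<or> (\<exists>u < k. u \<in> X \<and> support v j u) then 1 else 0 :: nat"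
  have s1: "placed X ?s" by (rule placed_frame[OF s(1)]) simp_all
  have "wp (n * n) (For ''u'' (var ''n'') look) (\<lambda>s'. s' ''f'' 0 = ?f n) ?s"
  proof (rule wp_For[where I = "\<lambda>k s'. s' ''f'' 0 = ?f k"], goal_cases)
    case (3 s')
    show ?case using placedD(2)[OF placed_frame[OF s1 3 3 3 3 3 3]] by simp
  next
    case 5
    show ?case using placedD(5)[OF s(1)] s(3) by auto
  next
    case (6 k s2)
    have s2: "placed X s2" using placed_frame[OF s1 6(2) 6(2) 6(2) 6(2) 6(2) 6(2)] by simp
    have "s2 ''v'' 0 = v" "s2 ''j'' 0 = j"
      using 6(2)[of "''v''"] 6(2)[of "''j''"] s by simp_all
    then show ?case
      by (rule wp_mono[OF wp_look[OF s2 6(4) _ _ 6(1) v]]) (use 6(3) in \<open>auto simp: less_Suc_eq\<close>)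
  qed simp_all
  then show "wp (n * n) (For ''u'' (var ''n'') look) (wp (n * n) (Cond (var ''f'') Skip (assign ''ok'' (Const 0)))
    (\<lambda>s'. s' ''ok'' 0 = (if X = {} \<and> j = 0 \<or> (\<exists>u \<in> X. support v j u) then s ''ok'' 0 else 0))) ?s"
  proof (rule wp_mono)
    fix s' assume f: "s' ''f'' 0 = ?f n" and fr: "\<And>x. x \<notin> mods (For ''u'' (var ''n'') look) \<Longrightarrow> s' x = ?s x"
    define ok where "ok \<longleftrightarrow> X = {} \<and> j = 0 \<or> (\<exists>u \<in> X. support v j u)"
    have "(\<exists>u < n. u \<in> X \<and> support v j u) \<longleftrightarrow> (\<exists>u \<in> X. support v j u)" using X by auto
    then have "s' ''f'' 0 \<noteq> 0 \<longleftrightarrow> ok" unfolding f ok_def by simp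
    moreover have "s' ''ok'' 0 = s ''ok'' 0" using fr[of "''ok''"] by simp
    ultimately show "wp (n * n) (Cond (var ''f'') Skip (assign ''ok'' (Const 0)))
        (\<lambda>s'. s' ''ok'' 0 = (if X = {} \<and> j = 0 \<or> (\<exists>u \<in> X. support v j u) then s ''ok'' 0 else 0)) s'"
      unfolding ok_def[symmetric] by (intro wp_Cond wp_Skip wp_Store) simp_all
  qed
qed

lemma wp_check_vertex:
  assumes s: "placed X s" "s ''v'' 0 = v" and v: "v < n" and X: "X \<subseteq> {..<n}" and lev: "lev v < n"
  shows "wp (n * n) check_vertex (\<lambda>s'. s' ''g'' 0 = (if addable X v then Suc v else s ''g'' 0)) s"
  unfolding check_vertex_def
proof (rule wp_Seq, rule wp_Store, rule wp_Seq)
  let ?s = "s(''ok'' := (s ''ok'')(expr_val (Const 0) s :=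
    expr_val (Minus (Const 1) (Cell ''pl'' (var ''v''))) s))"
  let ?ok = "\<lambda>k. if v \<notin> X \<and> (\<forall>j < k. X = {} \<and> j = 0 \<or> (\<exists>u \<in> X. support v j u)) then 1 else 0 :: nat"
  let ?loop = "For ''j'' (Plus (Cell ''lev'' (var ''v'')) (Const 1)) check_level"
  have s1: "placed X ?s" by (rule placed_frame[OF s(1)]) simp_all
  have "wp (n * n) ?loop (\<lambda>s'. s' ''ok'' 0 = ?ok (Suc (lev v))) ?s"
  proof (rule wp_For[where I = "\<lambda>k s'. s' ''ok'' 0 = ?ok k" and N = "Suc (lev v)"], goal_cases)
    case 2
    have "Suc (lev v) \<le> n" using lev by simp
    then show ?case using le_square[of n] by linarith
  next
    case (3 s')
    have "placed X s'" using placed_frame[OF s1 3 3 3 3 3 3] by simp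
    moreover have "s' ''v'' 0 = v" using 3[of "''v''"] s(2) by simp
    ultimately show ?case using placedD(3)[of X s' v] v by simp
  next
    case 5
    show ?case using placedD(4)[OF s(1) v] s(2) by auto
  next
    case (6 k s2)
    have s2: "placed X s2" using placed_frame[OF s1 6(2) 6(2) 6(2) 6(2) 6(2) 6(2)] by simp
    have "s2 ''v'' 0 = v" using 6(2)[of "''v''"] s(2) by simp
    then show ?case
      by (rule wp_mono[OF wp_check_level[OF s2 _ 6(4) v X]]) (use 6(3) in \<open>auto simp: less_Suc_eq\<close>)
  qed simp_all
  then show "wp (n * n) ?loop (wp (n * n) (Cond (var ''ok'') (assign ''g'' (Plus (var ''v'') (Const 1))) Skip)
    (\<lambda>s'. s' ''g'' 0 = (if addable X v then Suc v else s ''g'' 0))) ?s"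
  proof (rule wp_mono)
    fix s' assume ok: "s' ''ok'' 0 = ?ok (Suc (lev v))" and fr: "\<And>x. x \<notin> mods ?loop \<Longrightarrow> s' x = ?s x"
    have "s' ''g'' 0 = s ''g'' 0" "s' ''v'' 0 = v" using fr[of "''g''"] fr[of "''v''"] s(2) by simp_all
    moreover have "s' ''ok'' 0 \<noteq> 0 \<longleftrightarrow> addable X v" unfolding ok addable_iff_support using v by simp
    ultimately show "wp (n * n) (Cond (var ''ok'') (assign ''g'' (Plus (var ''v'') (Const 1))) Skip)
        (\<lambda>s'. s' ''g'' 0 = (if addable X v then Suc v else s ''g'' 0)) s'"
      by (intro wp_Cond wp_Skip wp_Store) simp_all
  qed
qed

lemma wp_choose:
  assumes s: "placed X s" and X: "X \<subseteq> {..<n}" and lev: "\<And>v. v < n \<Longrightarrow> lev v < n"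
    and ex: "\<exists>v. addable X v"
  shows "wp (n * n) (Seq (assign ''g'' (Const 0)) (For ''v'' (var ''n'') check_vertex))
    (\<lambda>s'. \<exists>v. s' ''g'' 0 = Suc v \<and> addable X v) s"
proof (rule wp_Seq, rule wp_Store)
  let ?s = "s(''g'' := (s ''g'')(expr_val (Const 0) s := expr_val (Const 0) s))"
  let ?I = "\<lambda>k s. s ''g'' 0 = 0 \<and> (\<forall>v < k. \<not> addable X v) \<or> (\<exists>v. s ''g'' 0 = Suc v \<and> addable X v)"
  have s1: "placed X ?s" by (rule placed_frame[OF s]) simp_all
  have "wp (n * n) (For ''v'' (var ''n'') check_vertex) (?I n) ?s"
  proof (rule wp_For[where I = ?I], goal_cases)
    case (3 s')
    show ?case using placedD(2)[OF placed_frame[OF s1 3 3 3 3 3 3]] by simp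
  next
    case (6 k s2)
    have s2: "placed X s2" using placed_frame[OF s1 6(2) 6(2) 6(2) 6(2) 6(2) 6(2)] by simp
    show ?case
      by (rule wp_mono[OF wp_check_vertex[OF s2 6(4) 6(1) X lev[OF 6(1)]]])
        (use 6(3) in \<open>auto simp: less_Suc_eq\<close>)
  qed simp_all
  then show "wp (n * n) (For ''v'' (var ''n'') check_vertex) (\<lambda>s'. \<exists>v. s' ''g'' 0 = Suc v \<and> addable X v) ?s"
  proof (rule wp_mono)
    fix s' assume I: "?I n s'"
    obtain v where v: "addable X v" using ex by (rule exE)
    then have "v < n" by (simp add: addable_def)
    with v I show "\<exists>v. s' ''g'' 0 = Suc v \<and> addable X v" by (elim disjE conjE) simp_all
  qed
qed

lemma wp_append_all:
  assumes conn: "\<And>X. \<lbrakk>X \<subseteq> {..<n}; X \<noteq> {}; \<And>u v. u \<in> X \<Longrightarrow> (u, v) \<in> E \<Longrightarrow> v \<in> X\<rbrakk> \<Longrightarrow> X = {..<n}"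
    and lev: "\<And>v. v < n \<Longrightarrow> lev v < n"
    and s: "loaded n E s" "\<And>w. w < n \<Longrightarrow> s ''lev'' w = lev w" "s ''pl'' = (\<lambda>_. 0)"
  shows "wp (n * n) append_all (\<lambda>s'. layered (ordering_output n s')) s"
proof -
  define I where "I r s' \<longleftrightarrow> layered (map (s' ''out'') [0..<r]) \<and>
    (\<forall>w < n. s' ''pl'' w = (if w \<in> s' ''out'' ` {..<r} then 1 else 0))" for r and s' :: state
  have I_stable: "I r (s'(x := f)) = I r s'" if "x \<noteq> ''out''" "x \<noteq> ''pl''" for r s' x f
    using that by (simp add: I_def)
  have "wp (n * n) append_all (I n) s"
    unfolding append_all_def
  proof (rule wp_For[where I = I], goal_cases)
    case (3 s')
    show ?case using loaded_n[OF loaded_frame[OF s(1) 3 3 3]] by simp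
  next
    case 5
    show ?case using s(3) by (simp add: I_def layered_Nil)
  next
    case (6 r s1)
    define X where "X = s1 ''out'' ` {..<r}"
    have lay: "layered (map (s1 ''out'') [0..<r])" using 6(3) by (simp add: I_def)
    have set: "set (map (s1 ''out'') [0..<r]) = X" by (auto simp: X_def)
    have X: "X \<subseteq> {..<n}" "card X = r"
      using layered_distinct[OF lay] distinct_card[of "map (s1 ''out'') [0..<r]"] unfolding set by simp_all
    \<comment> \<open>A layered list has distinct entries, so after \<open>r < n\<close> rounds some
      vertex is still missing, and \<open>exists_addable\<close> applies.\<close>
    then have "X \<subset> {..<n}" using 6(1) by auto
    then have ex: "\<exists>v. addable X v" by (intro exists_addable conn)
    have "loaded n E s1" using loaded_frame[OF s(1) 6(2) 6(2) 6(2)] by simp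
    moreover have "s1 ''lev'' w = lev w" if "w < n" for w using 6(2)[of "''lev''"] s(2)[OF that] by simp
    moreover have "s1 ''r'' 0 = 0 \<longleftrightarrow> X = {}" using 6(4) by (auto simp: X_def)
    ultimately have pl: "placed X s1" using 6(3) by (simp add: placed_def I_def X_def)
    show ?case
    proof (rule wp_Seq, rule wp_mono[OF wp_choose[OF pl X(1) lev ex]])
      fix s2 assume "\<exists>v. s2 ''g'' 0 = Suc v \<and> addable X v"
        and fr: "\<And>x. x \<notin> mods (Seq (assign ''g'' (Const 0)) (For ''v'' (var ''n'') check_vertex)) \<Longrightarrow> s2 x = s1 x"
      then obtain v where v: "s2 ''g'' 0 = Suc v" "addable X v" by blast
      have s2: "s2 ''out'' = s1 ''out''" "s2 ''pl'' = s1 ''pl''" "s2 ''r'' 0 = r"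
        using fr[of "''out''"] fr[of "''pl''"] fr[of "''r''"] 6(4) by simp_all
      have "map ((s1 ''out'')(r := v)) [0..<Suc r] = map (s1 ''out'') [0..<r] @ [v]" by simp
      then have "layered (map ((s1 ''out'')(r := v)) [0..<Suc r])"
        using lay v(2) set by (simp only: layered_snoc)
      moreover have "((s1 ''out'')(r := v)) ` {..<Suc r} = insert v X" by (auto simp: X_def)
      moreover have "s1 ''pl'' w = (if w \<in> X then 1 else 0)" if "w < n" for w
        using 6(3) that by (simp add: I_def X_def)
      ultimately show "wp (n * n) (Seq (Store ''out'' (var ''r'') (Minus (var ''g'') (Const 1)))
          (Store ''pl'' (Minus (var ''g'') (Const 1)) (Const 1))) (I (Suc r)) s2"
        by (intro wp_Seq wp_Store) (simp add: I_def s2 v(1) del: upt_Suc)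
    qed
  qed (simp_all add: I_stable)
  then show ?thesis
    by (rule wp_mono) (simp add: I_def ordering_output_def)
qed

end

definition good_ordering_program :: com where
  "good_ordering_program = Seq row_table (Seq orient (Seq levels append_all))"

lemma wp_good_ordering_program:
  assumes G: "connected_graph G" "comparability_graph G" "pverts G = {..<n}"
  shows "wp (n * n) good_ordering_program
    (\<lambda>s. good_connected_ordering G (ordering_output n s)) (graph_input n G)"
proof -
  let ?s = "graph_input n G" and ?E = "parcs G"
  have pG: "pair_graph G" using G(1) by (simp add: connected_graph_def)
  obtain T where T: "orients ?E T" "trans T" using comparability_orients[OF G(2)] by blast
  have E: "?E \<subseteq> {..<n} \<times> {..<n}"
    using transitive_orientation.E_sub[OF transitive_orientation_pair_graph[OF pG T]] G(3) by simp
  have "wp (n * n) row_table (loaded n ?E) ?s"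
    by (rule wp_row_table) (auto simp: graph_input_def enc_def)
  then show ?thesis
    unfolding good_ordering_program_def
  proof (rule wp_Seq[OF wp_mono])
    fix s1 assume s1: "loaded n ?E s1" and fr: "\<And>x. x \<notin> mods row_table \<Longrightarrow> s1 x = ?s x"
    have z1: "s1 ''D'' = (\<lambda>_. 0)" "s1 ''lev'' = (\<lambda>_. 0)" "s1 ''pl'' = (\<lambda>_. 0)" "s1 ''p'' 0 = 0"
      using fr[of "''D''"] fr[of "''lev''"] fr[of "''pl''"] fr[of "''p''"]
      by (simp_all add: row_table_def graph_input_def)
    show "wp (n * n) (Seq orient (Seq levels append_all))
        (\<lambda>s. good_connected_ordering G (ordering_output n s)) s1"
    proof (rule wp_Seq[OF wp_mono[OF wp_orient[OF E T s1 z1(1)]]])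
      fix s2 assume "\<exists>D. s2 ''D'' = enc n D \<and> orients ?E D \<and> trans D"
        and fr: "\<And>x. x \<notin> mods orient \<Longrightarrow> s2 x = s1 x"
      then obtain D where D: "s2 ''D'' = enc n D" "orients ?E D" "trans D" by blast
      \<comment> \<open>The levels belong to the orientation \<open>D\<close> found by the program,
        which may differ from \<open>T\<close>.\<close>
      interpret lpg: levelled_pair_graph G "level D (pverts G)"
        by (rule levelled_pair_graph_level[OF G(1) D(2,3)])
      interpret to: transitive_orientation "{..<n}" ?E D
        using transitive_orientation_pair_graph[OF pG D(2,3)] G(3) by simp
      interpret ng: numbered_graph n ?E "level D {..<n}" by unfold_locales
      have s2: "loaded n ?E s2" using loaded_frame[OF s1 fr fr fr] by simp
      have z2: "s2 ''lev'' = (\<lambda>_. 0)" "s2 ''pl'' = (\<lambda>_. 0)" "s2 ''p'' 0 = 0"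
        using fr[of "''lev''"] fr[of "''pl''"] fr[of "''p''"] z1 by simp_all
      show "wp (n * n) (Seq levels append_all)
          (\<lambda>s. good_connected_ordering G (ordering_output n s)) s2"
      proof (rule wp_Seq[OF wp_mono[OF wp_levels[OF to.transitive_orientation_axioms s2 D(1) z2(3,1)]]])
        fix s3 assume lev: "\<forall>w < n. s3 ''lev'' w = level D {..<n} w"
          and fr: "\<And>x. x \<notin> mods levels \<Longrightarrow> s3 x = s2 x"
        have s3: "loaded n ?E s3" using loaded_frame[OF s2 fr fr fr] by simp
        have pl: "s3 ''pl'' = (\<lambda>_. 0)" using fr[of "''pl''"] z2(2) by simp
        have "wp (n * n) append_all (\<lambda>s'. to.layered (ordering_output n s')) s3"
        proof (rule ng.wp_append_all[OF _ _ s3 _ pl])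
          show "X = {..<n}" if "X \<subseteq> {..<n}" "X \<noteq> {}" "\<And>u v. u \<in> X \<Longrightarrow> (u, v) \<in> ?E \<Longrightarrow> v \<in> X" for X
            using connected_graph_closed[OF G(1), of X] that unfolding G(3) by blast
          show "level D {..<n} v < n" if "v < n" for v using to.level_less_card[of v] that by simp
        qed (use lev in simp)
        then show "wp (n * n) append_all (\<lambda>s. good_connected_ordering G (ordering_output n s)) s3"
        proof (rule wp_mono)
          fix s assume "to.layered (ordering_output n s)"
          then have "lpg.layered (ordering_output n s)" unfolding G(3) .
          then show "good_connected_ordering G (ordering_output n s)"
            by (rule lpg.layered_good) (simp add: ordering_output_def G(3))
        qed
      qed
    qed
  qed
qed

lemma poly_time_good_connected_ordering:
  "poly_time_ordering (\<lambda>G. connected_graph G \<and> comparability_graph G) good_connected_ordering"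
proof -
  obtain p :: "nat poly" where p: "\<And>n. run_time (n * n) good_ordering_program = poly p n"
    using run_time_poly by blast
  show ?thesis
    unfolding poly_time_ordering_def
  proof (intro exI[of _ good_ordering_program] exI[of _ p] allI impI)
    fix n and G :: "nat pair_pre_digraph"
    assume "pair_graph G \<and> pverts G = {..<n} \<and> connected_graph G \<and> comparability_graph G"
    then have "wp (n * n) good_ordering_program
        (\<lambda>s. good_connected_ordering G (ordering_output n s)) (graph_input n G)"
      by (intro wp_good_ordering_program) simp_all
    then show "\<exists>t s. exec good_ordering_program (graph_input n G) t s \<and> t \<le> poly p n \<and>
        good_connected_ordering G (ordering_output n s)"
      unfolding wp_def p .
  qed
qed

theorem theorem7:
  shows "(\<forall>G :: 'a pair_pre_digraph. comparability_graph G \<longrightarrow> \<not> ugly G) \<and>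
    (\<forall>G :: 'a pair_pre_digraph. connected_graph G \<and> comparability_graph G \<longrightarrow>
        (\<exists>\<sigma>. good_connected_ordering G \<sigma>)) \<and>
    poly_time_ordering (\<lambda>G. connected_graph G \<and> comparability_graph G) good_connected_ordering"
proof (intro conjI allI impI)
  fix G :: "'a pair_pre_digraph"
  assume G: "comparability_graph G"
  show "\<not> ugly G"
  proof (cases "connected_graph G")
    case True
    from comparability_good_connected_ordering[OF this G] show ?thesis
      using good_connected_ordering_not_ugly by blast
  qed (simp add: ugly_def)
next
  fix G :: "'a pair_pre_digraph"
  assume "connected_graph G \<and> comparability_graph G"
  then show "\<exists>\<sigma>. good_connected_ordering G \<sigma>"
    using comparability_good_connected_ordering by blast
qed (rule poly_time_good_connected_ordering)

end
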